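(* Let $n$ be a positive integer. The coefficient body $\mathbf{X}_n(\mathscr{P})$ of order $n$ for the Carathéodory class $\mathscr{P}$ is expressed as $\mathbf{X}_n(\mathscr{P})=\{1\}\times 2\mathbf{V}_n$, where $\mathbf{V}_n$ is a convex body in $\mathbb{C}^n$. Moreover, the map $$\vec{T}_n(\gamma_1,\dots,\gamma_n)=(T_1(\gamma_1),T_2(\gamma_1,\gamma_2),\dots,T_n(\gamma_1,\dots,\gamma_n))$$ is a continuous mapping of $\overline{\mathbb{D}}^n$ onto $\mathbf{V}_n$ and satisfies $\vec{T}_n(\mathbb{D}^n)=\operatorname{Int}\mathbf{V}_n$ and $\vec{T}_n(\partial\overline{\mathbb{D}}^n)=\partial\mathbf{V}_n$. In addition, $\vec{T}_n:\mathbb{D}^n\to\operatorname{Int}\mathbf{V}_n$ is a real analytic diffeomorphism, but, for $n=2,3,\dots$, $\vec{T}_n$ is not injective on the boundary $\partial\overline{\mathbb{D}}^n$ of $\overline{\mathbb{D}}^n$.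
   Context: $\mathbb{D}=\{z\in\mathbb{C}:|z|<1\}$, $\overline{\mathbb{D}}$ is its closure, and $\operatorname{Hol}(\mathbb{D})$ is the set of analytic functions on $\mathbb{D}$. $\overline{\mathbb{D}}^n=(\overline{\mathbb{D}})^n$ is the closed polydisk in $\mathbb{C}^n$ and $\partial\overline{\mathbb{D}}^n=\overline{\mathbb{D}}^n\setminus\mathbb{D}^n$ is its topological boundary. The Carathéodory class is $\mathscr{P}=\{g\in\operatorname{Hol}(\mathbb{D}): g(0)=1,\ \operatorname{Re} g>0\}$. For a subclass $\mathscr{F}$ of $\operatorname{Hol}(\mathbb{D})$, the coefficient body of order $n$ is $$\mathbf{X}_n(\mathscr{F})=\{(a_0,a_1,\dots,a_n)\in\mathbb{C}^{n+1}: f(z)=a_0+a_1z+\cdots+a_nz^n+O(z^{n+1})\ (z\to 0)\text{ for some } f\in\mathscr{F}\}.$$ A subset of $\mathbb{R}^d$ is called a convex body if it is compact, convex, and has non-empty interior; $\mathbb{C}^n$ is identified with $\mathbb{R}^{2n}$. $\operatorname{Int}$ and $\partial$ denote interior and boundary in $\mathbb{C}^n$, and $2\mathbf{V}_n=\{2v:v\in\mathbf{V}_n\}$. The functions $F_n$ of $n$ complex variables are defined inductively by $F_1(\gamma_1)=\gamma_1$ and, for $n\ge 2$, $$F_n(\gamma_1,\dots,\gamma_n)=(1-|\gamma_1|^2)F_{n-1}(\gamma_2,\dots,\gamma_n)-\bar\gamma_1\sum_{k=2}^{n-1}F_{n-k}(\gamma_2,\dots,\gamma_{n-k+1})F_k(\gamma_1,\dots,\gamma_k).$$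 The polynomials $Q_n$ are defined inductively by $Q_1(x_1)=x_1$ and, for $n\ge2$, $$Q_n(x_1,\dots,x_n)=x_n+\sum_{k=1}^{n-1}x_{n-k}Q_k(x_1,\dots,x_k).$$ The functions $T_n$ are defined by $$T_n(\gamma_1,\dots,\gamma_n)=Q_n(F_1(\gamma_1),F_2(\gamma_1,\gamma_2),\dots,F_n(\gamma_1,\dots,\gamma_n)).$$ *)

theory Defs
  imports "HOL-Complex_Analysis.Complex_Analysis" "HOL-Library.Landau_Symbols"
begin

text \<open>The complex space of dimension n is \<^typ>\<open>complex ^ 'n\<close> with n = \<^term>\<open>CARD('n)\<close>.
  The linear order on the index type determines which coordinate is the k-th one; coordinates
  are numbered 1, ..., n.\<close>

definition pos :: "'n::{finite,linorder} \<Rightarrow> nat" where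
  "pos i = card {..i}"

lemma bij_betw_pos: "bij_betw (pos :: 'n::{finite,linorder} \<Rightarrow> nat) UNIV {1..CARD('n)}"
proof -
  have "strict_mono (pos :: 'n \<Rightarrow> nat)"
    unfolding strict_mono_def pos_def by (auto intro!: psubset_card_mono)
  then have inj: "inj (pos :: 'n \<Rightarrow> nat)" by (rule strict_mono_imp_inj_on)
  have "pos i \<in> {1..CARD('n)}" for i :: 'n
    unfolding pos_def by (auto simp: Suc_le_eq card_gt_0_iff intro: card_mono)
  then have "range (pos :: 'n \<Rightarrow> nat) \<subseteq> {1..CARD('n)}" by auto
  moreover have "card (range (pos :: 'n \<Rightarrow> nat)) = card {1..CARD('n)}"
    using inj by (simp add: card_image)
  ultimately have "range (pos :: 'n \<Rightarrow> nat) = {1..CARD('n)}"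
    by (intro card_subset_eq) auto
  with inj show ?thesis by (simp add: bij_betw_def)
qed

text \<open>The k-th coordinate, for k = 1, ..., n; only these k are ever relevant.\<close>

definition coord :: "complex ^ 'n::{finite,linorder} \<Rightarrow> nat \<Rightarrow> complex" where
  "coord v k = v $ (THE i. pos i = k)"

lemma coord_pos: "coord v (pos i) = v $ i"
proof -
  have "(THE j. pos j = pos i) = i"
    using bij_betw_pos[where 'n = 'a] by (auto simp: bij_betw_def inj_def)
  then show ?thesis by (simp add: coord_def)
qed

definition polydisk :: "(complex ^ 'n) set" where
  "polydisk = {\<gamma>. \<forall>i. \<gamma> $ i \<in> ball 0 1}"

definition closed_polydisk :: "(complex ^ 'n) set" where
  "closed_polydisk = {\<gamma>. \<forall>i. \<gamma> $ i \<in> cball 0 1}"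

definition caratheodory :: "(complex \<Rightarrow> complex) set" where
  "caratheodory = {g. g holomorphic_on ball 0 1 \<and> g 0 = 1 \<and> (\<forall>z\<in>ball 0 1. Re (g z) > 0)}"

text \<open>Complex (n+1)-space is split as the product of the a_0-axis and the space of the
  remaining coordinates (a_1, ..., a_n).\<close>

definition coefficient_body ::
    "(complex \<Rightarrow> complex) set \<Rightarrow> (complex \<times> (complex ^ 'n::{finite,linorder})) set" where
  "coefficient_body \<F> = {(a0, a). \<exists>f\<in>\<F>.
     (\<lambda>z. f z - (a0 + (\<Sum>k = 1..CARD('n). coord a k * z ^ k))) \<in> O[at 0](\<lambda>z. z ^ (CARD('n) + 1))}"

definition convex_body :: "'a::euclidean_space set \<Rightarrow> bool" where
  "convex_body S \<longleftrightarrow> compact S \<and> convex S \<and> interior S \<noteq> {}"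

text \<open>\<^term>\<open>F n\<close>, \<^term>\<open>Q n\<close> and \<^term>\<open>T n\<close> take the whole sequence of variables but depend only on
  those with indices 1, ..., n. Precomposing with \<^const>\<open>Suc\<close> makes the variables start at the
  second one. The value at n = 0 is a dummy which the recursions never use.\<close>

fun F :: "nat \<Rightarrow> (nat \<Rightarrow> complex) \<Rightarrow> complex" where
  "F n \<gamma> =
     (if n = 0 then 0 else if n = 1 then \<gamma> 1
      else of_real (1 - (cmod (\<gamma> 1))\<^sup>2) * F (n - 1) (\<gamma> \<circ> Suc)
           - cnj (\<gamma> 1) * (\<Sum>k = 2..n - 1. F (n - k) (\<gamma> \<circ> Suc) * F k \<gamma>))"

fun Q :: "nat \<Rightarrow> (nat \<Rightarrow> complex) \<Rightarrow> complex" where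
  "Q n x = (if n = 0 then 0 else x n + (\<Sum>k = 1..n - 1. x (n - k) * Q k x))"

declare F.simps [simp del] Q.simps [simp del]

definition T :: "nat \<Rightarrow> (nat \<Rightarrow> complex) \<Rightarrow> complex" where
  "T n \<gamma> = Q n (\<lambda>k. F k \<gamma>)"

definition T_vec :: "complex ^ 'n::{finite,linorder} \<Rightarrow> complex ^ 'n::{finite,linorder}" where
  "T_vec \<gamma> = (\<chi> i. T (pos i) (coord \<gamma>))"

text \<open>Real analyticity: around each point of the open set S, f is the sum of an (unconditionally,
  equivalently absolutely) convergent power series in the real coordinates. The multi-indices are
  the functions from \<^const>\<open>Basis\<close> to the natural numbers.\<close>

definition real_analytic_on ::
    "('a::euclidean_space \<Rightarrow> 'b::euclidean_space) \<Rightarrow> 'a set \<Rightarrow> bool"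
    (infixl "real'_analytic'_on" 50) where
  "f real_analytic_on S \<longleftrightarrow> open S \<and>
     (\<forall>x0\<in>S. \<exists>r>0. \<exists>c :: ('a \<Rightarrow> nat) \<Rightarrow> 'b. \<forall>x\<in>ball x0 r.
        ((\<lambda>\<alpha>. (\<Prod>b\<in>Basis. ((x - x0) \<bullet> b) ^ \<alpha> b) *\<^sub>R c \<alpha>) has_sum f x) (Basis \<rightarrow>\<^sub>E UNIV))"

definition real_analytic_diffeomorphism ::
    "('a::euclidean_space \<Rightarrow> 'b::euclidean_space) \<Rightarrow> 'a set \<Rightarrow> 'b set \<Rightarrow> bool" where
  "real_analytic_diffeomorphism f S S' \<longleftrightarrow>
     bij_betw f S S' \<and> f real_analytic_on S \<and> inv_into S f real_analytic_on S'"

end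

theory Submission
  imports Defs
begin

text \<open>Writing g = (1 + z f)/(1 - z f) turns the Caratheodory class into the unit ball of bounded
  analytic functions on the disc, and Schur's algorithm
  f = (\<gamma>_1 + z f_1)/(1 + cnj \<gamma>_1 z f_1) parametrises the Taylor coefficients of f by points of the
  closed polydisk; comparing coefficients in these two identities gives exactly the recursions for
  F_n and T_n, so the coefficient body is the image of the closed polydisk. The map is triangular:
  T_k is (1 - |\<gamma>_1|^2)...(1 - |\<gamma>_(k-1)|^2) \<gamma>_k plus a function of \<gamma>_1, ..., \<gamma>_(k-1). Hence it is
  injective on the open polydisk with an inverse obtained recursively by sums, products,
  conjugation and reciprocals, and invariance of domain makes its image open.\<close>

subsection \<open>Real analytic germs\<close>

text \<open>Convexity of the image is invisible in the formulas for \<open>T\<close>; it comes from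
  the class, which is convex and whose Taylor coefficients are linear in the function. For n \<ge> 2
  the map is not injective on the boundary of the polydisk: once a parameter is unimodular the Schur
  function is a constant and the later parameters disappear. So no homeomorphism argument describes
  the image there, and boundary points are kept out of the interior by the triangular formula
  instead, whose factors 1 - |\<gamma>_j|^2 vanish exactly where the algorithm stops. Since the
  recursions contain conjugates, analyticity is meant in real coordinates; hence germs with real
  monomials and complex coefficients.\<close>

abbreviation multi_indices :: "('a::euclidean_space \<Rightarrow> nat) set" where
  "multi_indices \<equiv> Basis \<rightarrow>\<^sub>E UNIV"

definition mdeg :: "('a::euclidean_space \<Rightarrow> nat) \<Rightarrow> nat" where
  "mdeg \<alpha> = (\<Sum>b\<in>Basis. \<alpha> b)"

definition mpow :: "'a::euclidean_space \<Rightarrow> ('a \<Rightarrow> nat) \<Rightarrow> real" where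
  "mpow y \<alpha> = (\<Prod>b\<in>Basis. (y \<bullet> b) ^ \<alpha> b)"

text \<open>Members of \<open>multi_indices\<close> take the value \<open>undefined\<close> outside
  \<open>Basis\<close>, so the pointwise sum is restricted again to stay among them.\<close>

definition madd :: "('a::euclidean_space \<Rightarrow> nat) \<Rightarrow> ('a \<Rightarrow> nat) \<Rightarrow> ('a \<Rightarrow> nat)" where
  "madd \<alpha> \<beta> = restrict (\<lambda>b. \<alpha> b + \<beta> b) Basis"

lemma madd_in: "madd \<alpha> \<beta> \<in> multi_indices"
  by (simp add: madd_def)

lemma mdeg_madd: "mdeg (madd \<alpha> \<beta>) = mdeg \<alpha> + mdeg \<beta>"
  by (simp add: mdeg_def madd_def sum.distrib)

lemma mpow_madd: "mpow y (madd \<alpha> \<beta>) = mpow y \<alpha> * mpow y \<beta>"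
  by (simp add: mpow_def madd_def power_add prod.distrib)

lemma abs_mpow_le:
  assumes "norm y \<le> r"
  shows "\<bar>mpow y \<alpha>\<bar> \<le> r ^ mdeg \<alpha>"
proof -
  have "\<bar>mpow y \<alpha>\<bar> = (\<Prod>b\<in>Basis. \<bar>y \<bullet> b\<bar> ^ \<alpha> b)"
    by (simp add: mpow_def abs_prod power_abs)
  also have "\<dots> \<le> (\<Prod>b\<in>Basis. r ^ \<alpha> b)"
    using assms by (intro prod_mono conjI power_mono) (auto intro: order_trans[OF Basis_le_norm])
  also have "\<dots> = r ^ mdeg \<alpha>"
    by (simp add: mdeg_def power_sum)
  finally show ?thesis .
qed

lemma norm_mpow_scaleR_le:
  fixes c :: "'b::real_normed_vector"
  assumes "norm y \<le> r"
  shows "norm (mpow y \<alpha> *\<^sub>R c) \<le> norm c * r ^ mdeg \<alpha>"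
  using abs_mpow_le[OF assms, of \<alpha>] by (simp add: mult.commute[of "norm c"] mult_right_mono)

text \<open>The weighted sums over coefficients are the norms of a Banach algebra of power series;
  this is what makes products and reciprocals available.\<close>

definition power_series_bound ::
    "'a::euclidean_space \<Rightarrow> real \<Rightarrow> ('a \<Rightarrow> complex) \<Rightarrow> real \<Rightarrow> bool" where
  "power_series_bound x0 r f B \<longleftrightarrow> 0 < r \<and> (\<exists>c K.
     ((\<lambda>\<alpha>. norm (c \<alpha>) * r ^ mdeg \<alpha>) has_sum K) multi_indices \<and> K \<le> B \<and>
     (\<forall>x. norm (x - x0) \<le> r \<longrightarrow> ((\<lambda>\<alpha>. mpow (x - x0) \<alpha> *\<^sub>R c \<alpha>) has_sum f x) multi_indices))"

text \<open>An absolutely summable family of monomials may be collected by exponent: the sum is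
  rearranged over the fibres of \<open>m\<close>, and the triangle inequality on each fibre keeps
  the weighted norm at most \<open>K\<close>. Monomials, sums and products below are instances with
  a suitable index set.\<close>

lemma power_series_bound_regroup:
  fixes x0 :: "'a::euclidean_space" and a :: "'i \<Rightarrow> complex"
  assumes r: "0 < r"
    and m: "m ` I \<subseteq> multi_indices"
    and K: "((\<lambda>i. norm (a i) * r ^ mdeg (m i)) has_sum K) I" "K \<le> B"
    and f: "\<And>x. norm (x - x0) \<le> r \<Longrightarrow> ((\<lambda>i. mpow (x - x0) (m i) *\<^sub>R a i) has_sum f x) I"
  shows "power_series_bound x0 r f B"
proof -
  define J where "J = (\<lambda>\<alpha>. {i \<in> I. m i = \<alpha>})"
  have bij: "bij_betw snd (Sigma multi_indices J) I"
    by (rule bij_betwI[where g = "\<lambda>i. (m i, i)"]) (use m in \<open>auto simp: J_def\<close>)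
  have sumJ: "(\<lambda>i. norm (a i)) summable_on J \<alpha>" for \<alpha>
  proof -
    \<comment> \<open>On a fibre the weight is a fixed positive number, so it can be
      cancelled.\<close>
    have "(\<lambda>i. norm (a i) * r ^ mdeg (m i)) summable_on J \<alpha>"
      using summable_on_subset_banach[OF has_sum_imp_summable[OF K(1)]] by (auto simp: J_def)
    then have "(\<lambda>i. norm (a i) * r ^ mdeg \<alpha>) summable_on J \<alpha>"
      by (rule summable_on_cong[THEN iffD1, rotated]) (simp add: J_def)
    then show ?thesis
      using r by (subst (asm) summable_on_cmult_left') auto
  qed
  define c where "c = (\<lambda>\<alpha>. infsum a (J \<alpha>))"
  define n where "n = (\<lambda>\<alpha>. infsum (\<lambda>i. norm (a i)) (J \<alpha>))"
  have c: "(a has_sum c \<alpha>) (J \<alpha>)" for \<alpha>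
    unfolding c_def by (rule has_sum_infsum[OF abs_summable_summable[OF sumJ]])
  have n: "((\<lambda>i. norm (a i)) has_sum n \<alpha>) (J \<alpha>)" for \<alpha>
    unfolding n_def by (rule has_sum_infsum[OF sumJ])
  have cn: "norm (c \<alpha>) \<le> n \<alpha>" for \<alpha>
    unfolding c_def n_def by (rule norm_infsum_bound[OF sumJ])
  have "((\<lambda>\<alpha>. n \<alpha> * r ^ mdeg \<alpha>) has_sum K) multi_indices"
  proof (rule has_sum_Sigma')
    show "((\<lambda>p. norm (a (snd p)) * r ^ mdeg (m (snd p))) has_sum K) (Sigma multi_indices J)"
      using K(1) by (subst has_sum_reindex_bij_betw[OF bij, where f = "\<lambda>i. norm (a i) * r ^ mdeg (m i)"])
    fix \<alpha>
    have "((\<lambda>i. norm (a i) * r ^ mdeg \<alpha>) has_sum n \<alpha> * r ^ mdeg \<alpha>) (J \<alpha>)"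
      by (intro has_sum_cmult_left n)
    then show "((\<lambda>i. norm (a (snd (\<alpha>, i))) * r ^ mdeg (m (snd (\<alpha>, i)))) has_sum n \<alpha> * r ^ mdeg \<alpha>) (J \<alpha>)"
      by (rule has_sum_cong[THEN iffD1, rotated]) (simp add: J_def)
  qed
  note nK = this
  have le: "norm (c \<alpha>) * r ^ mdeg \<alpha> \<le> n \<alpha> * r ^ mdeg \<alpha>" for \<alpha>
    using cn[of \<alpha>] r by (simp add: mult_right_mono)
  have "(\<lambda>\<alpha>. norm (norm (c \<alpha>) * r ^ mdeg \<alpha>)) summable_on multi_indices"
    by (rule Infinite_Sum.abs_summable_on_comparison_test'[OF has_sum_imp_summable[OF nK]]) (use le r in auto)
  from abs_summable_summable[OF this] obtain K' where K': "((\<lambda>\<alpha>. norm (c \<alpha>) * r ^ mdeg \<alpha>) has_sum K') multi_indices"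
    unfolding summable_on_def by blast
  have "K' \<le> K"
    by (rule has_sum_mono[OF K' nK]) (rule le)
  moreover have "((\<lambda>\<alpha>. mpow (x - x0) \<alpha> *\<^sub>R c \<alpha>) has_sum f x) multi_indices" if "norm (x - x0) \<le> r" for x
  proof (rule has_sum_Sigma')
    show "((\<lambda>p. mpow (x - x0) (m (snd p)) *\<^sub>R a (snd p)) has_sum f x) (Sigma multi_indices J)"
      using f[OF that] by (subst has_sum_reindex_bij_betw[OF bij, where f = "\<lambda>i. mpow (x - x0) (m i) *\<^sub>R a i"])
    fix \<alpha>
    have "((\<lambda>i. mpow (x - x0) \<alpha> *\<^sub>R a i) has_sum mpow (x - x0) \<alpha> *\<^sub>R c \<alpha>) (J \<alpha>)"
      by (intro has_sum_scaleR c)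
    then show "((\<lambda>i. mpow (x - x0) (m (snd (\<alpha>, i))) *\<^sub>R a (snd (\<alpha>, i))) has_sum mpow (x - x0) \<alpha> *\<^sub>R c \<alpha>) (J \<alpha>)"
      by (rule has_sum_cong[THEN iffD1, rotated]) (simp add: J_def)
  qed
  ultimately show ?thesis
    unfolding power_series_bound_def using r K' K(2) by force
qed

lemma power_series_boundE:
  assumes "power_series_bound x0 r f B"
  obtains c K where "0 < r" "((\<lambda>\<alpha>. norm (c \<alpha>) * r ^ mdeg \<alpha>) has_sum K) multi_indices" "K \<le> B" "0 \<le> K"
    "\<And>x. norm (x - x0) \<le> r \<Longrightarrow> ((\<lambda>\<alpha>. mpow (x - x0) \<alpha> *\<^sub>R c \<alpha>) has_sum f x) multi_indices"
proof -
  from assms obtain c K where *: "0 < r" "((\<lambda>\<alpha>. norm (c \<alpha>) * r ^ mdeg \<alpha>) has_sum K) multi_indices" "K \<le> B"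
    "\<And>x. norm (x - x0) \<le> r \<Longrightarrow> ((\<lambda>\<alpha>. mpow (x - x0) \<alpha> *\<^sub>R c \<alpha>) has_sum f x) multi_indices"
    unfolding power_series_bound_def by auto
  have "0 \<le> K" by (rule has_sum_nonneg[OF *(2)]) (use * in auto)
  with * show ?thesis using that by blast
qed

text \<open>The weighted coefficient norm dominates the supremum norm on the closed ball.\<close>

lemma power_series_bound_norm_le:
  assumes "power_series_bound x0 r f B" "norm (x - x0) \<le> r"
  shows "norm (f x) \<le> B"
proof -
  from assms(1) obtain c K where *: "0 < r" "((\<lambda>\<alpha>. norm (c \<alpha>) * r ^ mdeg \<alpha>) has_sum K) multi_indices" "K \<le> B"
    "\<And>x. norm (x - x0) \<le> r \<Longrightarrow> ((\<lambda>\<alpha>. mpow (x - x0) \<alpha> *\<^sub>R c \<alpha>) has_sum f x) multi_indices"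
    by (rule power_series_boundE) blast
  note le = norm_mpow_scaleR_le[OF assms(2)]
  have "(\<lambda>\<alpha>. norm (mpow (x - x0) \<alpha> *\<^sub>R c \<alpha>)) summable_on multi_indices"
    by (rule Infinite_Sum.abs_summable_on_comparison_test'[OF has_sum_imp_summable[OF *(2)]]) (rule le)
  then obtain L where L: "((\<lambda>\<alpha>. norm (mpow (x - x0) \<alpha> *\<^sub>R c \<alpha>)) has_sum L) multi_indices"
    unfolding summable_on_def by blast
  have "norm (f x) \<le> L" by (rule norm_has_sum_bound[OF L *(4)[OF assms(2)]])
  also have "L \<le> K" by (rule has_sum_mono[OF L *(2)]) (rule le)
  finally show ?thesis using *(3) by simp
qed

text \<open>Completeness in the form needed: series with summable norm bounds may be added termwise,
  even over an infinite index set. The geometric series for reciprocals uses this.\<close>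

lemma power_series_bound_sum:
  fixes f :: "'i \<Rightarrow> 'a::euclidean_space \<Rightarrow> complex"
  assumes r: "0 < r" and f: "\<And>i. i \<in> I \<Longrightarrow> power_series_bound x0 r (f i) (B i)"
    and B: "(B has_sum S) I"
    and g: "\<And>x. norm (x - x0) \<le> r \<Longrightarrow> ((\<lambda>i. f i x) has_sum g x) I"
  shows "power_series_bound x0 r g S"
proof -
  define P where "P = (\<lambda>i c K. ((\<lambda>\<alpha>. norm (c \<alpha>) * r ^ mdeg \<alpha>) has_sum K) multi_indices \<and> K \<le> B i \<and> 0 \<le> K \<and>
    (\<forall>x. norm (x - x0) \<le> r \<longrightarrow> ((\<lambda>\<alpha>. mpow (x - x0) \<alpha> *\<^sub>R c \<alpha>) has_sum f i x) multi_indices))"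
  have "\<exists>c K. P i c K" if "i \<in> I" for i
  proof -
    have *: "power_series_bound x0 r (f i) (B i)" using f that by blast
    obtain c K where "((\<lambda>\<alpha>. norm (c \<alpha>) * r ^ mdeg \<alpha>) has_sum K) multi_indices" "K \<le> B i" "0 \<le> K"
      "\<And>x. norm (x - x0) \<le> r \<Longrightarrow> ((\<lambda>\<alpha>. mpow (x - x0) \<alpha> *\<^sub>R c \<alpha>) has_sum f i x) multi_indices"
      by (rule power_series_boundE[OF *]) blast
    then show ?thesis unfolding P_def by (intro exI[of _ c] exI[of _ K]) simp
  qed
  then have "\<forall>i\<in>I. \<exists>c. \<exists>K. P i c K" by blast
  from bchoice[OF this] obtain c where "\<forall>i\<in>I. \<exists>K. P i (c i) K" by blast
  from bchoice[OF this] obtain K where K: "\<forall>i\<in>I. P i (c i) (K i)" by blast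
  have cK: "\<And>i. i \<in> I \<Longrightarrow> ((\<lambda>\<alpha>. norm (c i \<alpha>) * r ^ mdeg \<alpha>) has_sum K i) multi_indices"
    "\<And>i. i \<in> I \<Longrightarrow> K i \<le> B i" "\<And>i. i \<in> I \<Longrightarrow> 0 \<le> K i"
    "\<And>i x. i \<in> I \<Longrightarrow> norm (x - x0) \<le> r \<Longrightarrow> ((\<lambda>\<alpha>. mpow (x - x0) \<alpha> *\<^sub>R c i \<alpha>) has_sum f i x) multi_indices"
    using K unfolding P_def by simp_all
  have "(\<lambda>i. norm (K i)) summable_on I"
    by (rule Infinite_Sum.abs_summable_on_comparison_test'[OF has_sum_imp_summable[OF B]]) (use cK in auto)
  from abs_summable_summable[OF this] obtain L where L: "(K has_sum L) I"
    unfolding summable_on_def by blast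
  have "L \<le> S" by (rule has_sum_mono[OF L B]) (rule cK)
  have sm: "(\<lambda>p. norm (c (fst p) (snd p)) * r ^ mdeg (snd p)) summable_on Sigma I (\<lambda>_. multi_indices)"
    using cK(1) r by (intro summable_on_SigmaI[OF _ has_sum_imp_summable[OF L]]) auto
  show ?thesis
  proof (rule power_series_bound_regroup[OF r])
    show "snd ` (Sigma I (\<lambda>_. multi_indices)) \<subseteq> multi_indices" by auto
    show "((\<lambda>p. norm (c (fst p) (snd p)) * r ^ mdeg (snd p)) has_sum L) (Sigma I (\<lambda>_. multi_indices))"
      using cK(1) by (intro has_sum_SigmaI[OF _ L sm]) auto
    fix x assume x: "norm (x - x0) \<le> r"
    have "(\<lambda>p. norm (mpow (x - x0) (snd p) *\<^sub>R c (fst p) (snd p))) summable_on Sigma I (\<lambda>_. multi_indices)"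
      by (rule Infinite_Sum.abs_summable_on_comparison_test'[OF sm]) (rule norm_mpow_scaleR_le[OF x])
    then have "(\<lambda>p. mpow (x - x0) (snd p) *\<^sub>R c (fst p) (snd p)) summable_on Sigma I (\<lambda>_. multi_indices)"
      by (rule abs_summable_summable)
    then show "((\<lambda>p. mpow (x - x0) (snd p) *\<^sub>R c (fst p) (snd p)) has_sum g x) (Sigma I (\<lambda>_. multi_indices))"
      using cK(4) x by (intro has_sum_SigmaI[OF _ g[OF x]]) auto
  qed fact
qed

text \<open>The norm is submultiplicative: the product is summed over pairs of multi-indices, where
  it converges absolutely with total \<open>K * L\<close>, and is then regrouped by
  \<open>madd\<close>.\<close>

lemma power_series_bound_mult:
  assumes "power_series_bound x0 r f B" "power_series_bound x0 r g C"
  shows "power_series_bound x0 r (\<lambda>x. f x * g x) (B * C)"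
proof -
  from assms(1) obtain c K where c: "0 < r" "((\<lambda>\<alpha>. norm (c \<alpha>) * r ^ mdeg \<alpha>) has_sum K) multi_indices" "K \<le> B"
    "0 \<le> K" "\<And>x. norm (x - x0) \<le> r \<Longrightarrow> ((\<lambda>\<alpha>. mpow (x - x0) \<alpha> *\<^sub>R c \<alpha>) has_sum f x) multi_indices"
    by (rule power_series_boundE) blast
  from assms(2) obtain d L where d: "((\<lambda>\<alpha>. norm (d \<alpha>) * r ^ mdeg \<alpha>) has_sum L) multi_indices" "L \<le> C"
    "0 \<le> L" "\<And>x. norm (x - x0) \<le> r \<Longrightarrow> ((\<lambda>\<alpha>. mpow (x - x0) \<alpha> *\<^sub>R d \<alpha>) has_sum g x) multi_indices"
    by (rule power_series_boundE) blast
  have p1: "((\<lambda>\<beta>. (norm (c \<alpha>) * r ^ mdeg \<alpha>) * (norm (d \<beta>) * r ^ mdeg \<beta>)) has_sum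
      (norm (c \<alpha>) * r ^ mdeg \<alpha>) * L) multi_indices" for \<alpha>
    by (intro has_sum_cmult_right d)
  have p2: "((\<lambda>\<alpha>. (norm (c \<alpha>) * r ^ mdeg \<alpha>) * L) has_sum K * L) multi_indices"
    by (intro has_sum_cmult_left c)
  have sm: "(\<lambda>p. (norm (c (fst p)) * r ^ mdeg (fst p)) * (norm (d (snd p)) * r ^ mdeg (snd p)))
      summable_on Sigma multi_indices (\<lambda>_. multi_indices)"
    using p1 c(1) by (intro summable_on_SigmaI[OF _ has_sum_imp_summable[OF p2]]) auto
  show ?thesis
  proof (rule power_series_bound_regroup[OF c(1)])
    show "(\<lambda>p. madd (fst p) (snd p)) ` (Sigma multi_indices (\<lambda>_. multi_indices)) \<subseteq> multi_indices"
      using madd_in by auto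
    have "((\<lambda>p. (norm (c (fst p)) * r ^ mdeg (fst p)) * (norm (d (snd p)) * r ^ mdeg (snd p))) has_sum K * L)
      (Sigma multi_indices (\<lambda>_. multi_indices))"
      using p1 by (intro has_sum_SigmaI[OF _ p2 sm]) auto
    then show "((\<lambda>p. norm (c (fst p) * d (snd p)) * r ^ mdeg (madd (fst p) (snd p))) has_sum K * L)
      (Sigma multi_indices (\<lambda>_. multi_indices))"
      by (simp add: norm_mult mdeg_madd power_add mult_ac)
    show "K * L \<le> B * C" using c d by (intro mult_mono) auto
    fix x assume x: "norm (x - x0) \<le> r"
    have q1: "((\<lambda>\<beta>. (mpow (x - x0) \<alpha> *\<^sub>R c \<alpha>) * (mpow (x - x0) \<beta> *\<^sub>R d \<beta>)) has_sum
        (mpow (x - x0) \<alpha> *\<^sub>R c \<alpha>) * g x) multi_indices" for \<alpha>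
      by (intro has_sum_cmult_right d x)
    have q2: "((\<lambda>\<alpha>. (mpow (x - x0) \<alpha> *\<^sub>R c \<alpha>) * g x) has_sum f x * g x) multi_indices"
      by (intro has_sum_cmult_left c x)
    have "norm ((mpow (x - x0) \<alpha> *\<^sub>R c \<alpha>) * (mpow (x - x0) \<beta> *\<^sub>R d \<beta>)) \<le>
        (norm (c \<alpha>) * r ^ mdeg \<alpha>) * (norm (d \<beta>) * r ^ mdeg \<beta>)" for \<alpha> \<beta>
      unfolding norm_mult by (intro mult_mono norm_mpow_scaleR_le[OF x]) (use c(1) in auto)
    then have "(\<lambda>p. norm ((mpow (x - x0) (fst p) *\<^sub>R c (fst p)) * (mpow (x - x0) (snd p) *\<^sub>R d (snd p))))
      summable_on Sigma multi_indices (\<lambda>_. multi_indices)"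
      by (intro Infinite_Sum.abs_summable_on_comparison_test'[OF sm])
    then have "(\<lambda>p. (mpow (x - x0) (fst p) *\<^sub>R c (fst p)) * (mpow (x - x0) (snd p) *\<^sub>R d (snd p)))
      summable_on Sigma multi_indices (\<lambda>_. multi_indices)"
      by (rule abs_summable_summable)
    then have "((\<lambda>p. (mpow (x - x0) (fst p) *\<^sub>R c (fst p)) * (mpow (x - x0) (snd p) *\<^sub>R d (snd p))) has_sum f x * g x)
      (Sigma multi_indices (\<lambda>_. multi_indices))"
      using q1 by (intro has_sum_SigmaI[OF _ q2]) auto
    then show "((\<lambda>p. mpow (x - x0) (madd (fst p) (snd p)) *\<^sub>R (c (fst p) * d (snd p))) has_sum f x * g x)
      (Sigma multi_indices (\<lambda>_. multi_indices))"
      by (simp add: mpow_madd mult_ac)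
  qed
qed

lemma power_series_bound_monomial:
  assumes "0 < r" "\<alpha> \<in> multi_indices"
  shows "power_series_bound x0 r (\<lambda>x. mpow (x - x0) \<alpha> *\<^sub>R a) (norm a * r ^ mdeg \<alpha>)"
  by (rule power_series_bound_regroup[where I = "{()}" and m = "\<lambda>_. \<alpha>" and a = "\<lambda>_. a"
        and K = "norm a * r ^ mdeg \<alpha>"])
     (use assms in \<open>auto intro!: has_sum_finiteI\<close>)

lemma power_series_bound_const:
  assumes "0 < r"
  shows "power_series_bound x0 r (\<lambda>x. a) (norm a)"
  using power_series_bound_monomial[OF assms, of "restrict (\<lambda>_. 0) Basis" x0 a]
  by (simp add: mpow_def mdeg_def)

lemma power_series_bound_mono:
  "power_series_bound x0 r f B \<Longrightarrow> B \<le> C \<Longrightarrow> power_series_bound x0 r f C"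
  unfolding power_series_bound_def by force

lemma power_series_bound_power:
  assumes "power_series_bound x0 r f B"
  shows "power_series_bound x0 r (\<lambda>x. f x ^ n) (B ^ n)"
proof (induction n)
  case 0
  have "0 < r" using assms by (simp add: power_series_bound_def)
  then show ?case using power_series_bound_const[of r x0 1] by simp
next
  case (Suc n)
  then show ?case using power_series_bound_mult[OF assms Suc] by simp
qed

lemma power_series_bound_add:
  assumes "power_series_bound x0 r f B" "power_series_bound x0 r g C"
  shows "power_series_bound x0 r (\<lambda>x. f x + g x) (B + C)"
\<comment> \<open>Binary addition is a sum indexed by the two Booleans.\<close>
proof (rule power_series_bound_sum[where I = UNIV and f = "\<lambda>b. if b then f else g" and B = "\<lambda>b. if b then B else C"])
  show "0 < r" using assms by (simp add: power_series_bound_def)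
qed (use assms in \<open>auto intro!: has_sum_finiteI simp: UNIV_bool\<close>)

lemma power_series_bound_radius_mono:
  assumes "power_series_bound x0 r f B" "0 < s" "s \<le> r"
  shows "power_series_bound x0 s f B"
proof -
  from assms(1) obtain c K where c: "0 < r" "((\<lambda>\<alpha>. norm (c \<alpha>) * r ^ mdeg \<alpha>) has_sum K) multi_indices" "K \<le> B"
    "\<And>x. norm (x - x0) \<le> r \<Longrightarrow> ((\<lambda>\<alpha>. mpow (x - x0) \<alpha> *\<^sub>R c \<alpha>) has_sum f x) multi_indices"
    by (rule power_series_boundE) blast
  have le: "norm (c \<alpha>) * s ^ mdeg \<alpha> \<le> norm (c \<alpha>) * r ^ mdeg \<alpha>" for \<alpha>
    using assms by (intro mult_left_mono power_mono) auto
  have "(\<lambda>\<alpha>. norm (norm (c \<alpha>) * s ^ mdeg \<alpha>)) summable_on multi_indices"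
    by (rule Infinite_Sum.abs_summable_on_comparison_test'[OF has_sum_imp_summable[OF c(2)]]) (use le assms in auto)
  from abs_summable_summable[OF this] obtain L where L: "((\<lambda>\<alpha>. norm (c \<alpha>) * s ^ mdeg \<alpha>) has_sum L) multi_indices"
    unfolding summable_on_def by blast
  have "L \<le> K" by (rule has_sum_mono[OF L c(2)]) (rule le)
  then show ?thesis
    unfolding power_series_bound_def using L c assms(2,3) by (intro conjI exI[of _ c] exI[of _ L]) auto
qed

text \<open>Without a constant term every occurring monomial has degree at least 1, and (s/r)^deg
  \<le> s/r. Shrinking the radius thus makes the norm as small as desired, which the reciprocal
  requires.\<close>

lemma power_series_bound_shrink:
  assumes "power_series_bound x0 r f B" "0 < s" "s \<le> r" "f x0 = 0"
  shows "power_series_bound x0 s f (s / r * B)"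
proof -
  from assms(1) obtain c K where c: "0 < r" "((\<lambda>\<alpha>. norm (c \<alpha>) * r ^ mdeg \<alpha>) has_sum K) multi_indices" "K \<le> B"
    "\<And>x. norm (x - x0) \<le> r \<Longrightarrow> ((\<lambda>\<alpha>. mpow (x - x0) \<alpha> *\<^sub>R c \<alpha>) has_sum f x) multi_indices"
    by (rule power_series_boundE) blast
  let ?z = "restrict (\<lambda>_. 0) Basis :: 'a \<Rightarrow> nat"
  have pos: "0 < mdeg \<alpha>" if "\<alpha> \<in> multi_indices" "\<alpha> \<noteq> ?z" for \<alpha> :: "'a \<Rightarrow> nat"
  proof (rule ccontr)
    assume "\<not> 0 < mdeg \<alpha>"
    then have "\<forall>b\<in>Basis. \<alpha> b = 0" by (simp add: mdeg_def)
    then have "\<alpha> = ?z" using that(1) by (auto simp: fun_eq_iff PiE_def extensional_def)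
    with that show False by simp
  qed
  have mpow0: "mpow (0::'a) \<alpha> = 0" if "0 < mdeg \<alpha>" for \<alpha>
  proof -
    have "\<exists>b\<in>Basis. \<alpha> b \<noteq> 0"
    proof (rule ccontr)
      assume "\<not> (\<exists>b\<in>Basis. \<alpha> b \<noteq> 0)"
      then have "mdeg \<alpha> = 0" by (simp add: mdeg_def)
      with that show False by simp
    qed
    then obtain b where "b \<in> Basis" "\<alpha> b \<noteq> 0" by blast
    then show ?thesis by (auto simp: mpow_def intro!: bexI[of _ b])
  qed
  \<comment> \<open>At the centre all nonconstant monomials vanish, so the series reduces to its
    constant coefficient.\<close>
  have "c ?z = 0"
  proof (rule has_sum_unique)
    show "((\<lambda>\<alpha>. mpow (x0 - x0) \<alpha> *\<^sub>R c \<alpha>) has_sum 0) multi_indices"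
      using c(4)[of x0] c(1) assms(4) by simp
    have "((\<lambda>\<alpha>. mpow (x0 - x0) \<alpha> *\<^sub>R c \<alpha>) has_sum c ?z) {?z}"
      by (rule has_sum_finiteI) (auto simp: mpow_def)
    then show "((\<lambda>\<alpha>. mpow (x0 - x0) \<alpha> *\<^sub>R c \<alpha>) has_sum c ?z) multi_indices"
      by (rule has_sum_cong_neutral[THEN iffD1, rotated -1]) (use pos mpow0 in auto)
  qed
  have le: "norm (c \<alpha>) * s ^ mdeg \<alpha> \<le> s / r * (norm (c \<alpha>) * r ^ mdeg \<alpha>)" if "\<alpha> \<in> multi_indices" for \<alpha>
  proof (cases "\<alpha> = ?z")
    case True
    then show ?thesis using \<open>c ?z = 0\<close> by simp
  next
    case False
    then have "0 < mdeg \<alpha>" using pos that by blast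
    then obtain k where k: "mdeg \<alpha> = Suc k" using gr0_implies_Suc by blast
    have "s ^ k \<le> r ^ k" using assms by (intro power_mono) auto
    then have "s * s ^ k \<le> s * r ^ k" using assms by simp
    then have "s ^ mdeg \<alpha> \<le> s / r * r ^ mdeg \<alpha>"
      using c(1) by (simp add: k)
    then have "norm (c \<alpha>) * s ^ mdeg \<alpha> \<le> norm (c \<alpha>) * (s / r * r ^ mdeg \<alpha>)"
      by (intro mult_left_mono) auto
    then show ?thesis by (simp only: mult_ac)
  qed
  have sK: "((\<lambda>\<alpha>. s / r * (norm (c \<alpha>) * r ^ mdeg \<alpha>)) has_sum s / r * K) multi_indices"
    by (intro has_sum_cmult_right c)
  have "(\<lambda>\<alpha>. norm (norm (c \<alpha>) * s ^ mdeg \<alpha>)) summable_on multi_indices"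
    by (rule Infinite_Sum.abs_summable_on_comparison_test'[OF has_sum_imp_summable[OF sK]]) (use le assms in auto)
  from abs_summable_summable[OF this] obtain L where L: "((\<lambda>\<alpha>. norm (c \<alpha>) * s ^ mdeg \<alpha>) has_sum L) multi_indices"
    unfolding summable_on_def by blast
  have "L \<le> s / r * K" by (rule has_sum_mono[OF L sK]) (rule le)
  also have "\<dots> \<le> s / r * B" using c assms by (intro mult_left_mono) auto
  finally show ?thesis
    unfolding power_series_bound_def using L c assms(2,3) by (intro conjI exI[of _ c] exI[of _ L]) auto
qed

section \<open>The algebra of real analytic germs\<close>

definition analytic_germ :: "'a::euclidean_space \<Rightarrow> ('a \<Rightarrow> complex) \<Rightarrow> bool" where
  "analytic_germ x0 f \<longleftrightarrow> (\<exists>r B. power_series_bound x0 r f B)"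

lemma analytic_germ_common_radius:
  assumes "analytic_germ x0 f" "analytic_germ x0 g"
  obtains r B C where "power_series_bound x0 r f B" "power_series_bound x0 r g C"
proof -
  obtain r B s C where *: "power_series_bound x0 r f B" "power_series_bound x0 s g C"
    using assms by (auto simp: analytic_germ_def)
  then have "0 < r" "0 < s" by (auto simp: power_series_bound_def)
  then have "power_series_bound x0 (min r s) f B" "power_series_bound x0 (min r s) g C"
    using * by (auto intro: power_series_bound_radius_mono)
  then show ?thesis using that by blast
qed

lemma analytic_germ_const [intro]: "analytic_germ x0 (\<lambda>_. a)"
  using power_series_bound_const[of 1] by (auto simp: analytic_germ_def)

lemma analytic_germ_add [intro]:
  "analytic_germ x0 f \<Longrightarrow> analytic_germ x0 g \<Longrightarrow> analytic_germ x0 (\<lambda>x. f x + g x)"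
  by (erule (1) analytic_germ_common_radius) (auto simp: analytic_germ_def dest: power_series_bound_add)

lemma analytic_germ_mult [intro]:
  "analytic_germ x0 f \<Longrightarrow> analytic_germ x0 g \<Longrightarrow> analytic_germ x0 (\<lambda>x. f x * g x)"
  by (erule (1) analytic_germ_common_radius) (auto simp: analytic_germ_def dest: power_series_bound_mult)

lemma analytic_germ_diff [intro]:
  assumes "analytic_germ x0 f" "analytic_germ x0 g"
  shows "analytic_germ x0 (\<lambda>x. f x - g x)"
  using analytic_germ_add[OF assms(1) analytic_germ_mult[OF analytic_germ_const[of x0 "-1"] assms(2)]] by simp

lemma analytic_germ_sum [intro]:
  "(\<And>i. i \<in> I \<Longrightarrow> analytic_germ x0 (f i)) \<Longrightarrow> analytic_germ x0 (\<lambda>x. \<Sum>i\<in>I. f i x)"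
  by (induction I rule: infinite_finite_induct) auto

lemma analytic_germ_prod [intro]:
  "(\<And>i. i \<in> I \<Longrightarrow> analytic_germ x0 (f i)) \<Longrightarrow> analytic_germ x0 (\<lambda>x. \<Prod>i\<in>I. f i x)"
  by (induction I rule: infinite_finite_induct) auto

text \<open>The monomials are real, so conjugation acts on the coefficients alone and preserves
  their norms.\<close>

lemma analytic_germ_cnj [intro]:
  assumes "analytic_germ x0 f"
  shows "analytic_germ x0 (\<lambda>x. cnj (f x))"
proof -
  obtain r B where "power_series_bound x0 r f B"
    using assms by (auto simp: analytic_germ_def)
  then obtain c K where c: "0 < r" "((\<lambda>\<alpha>. norm (c \<alpha>) * r ^ mdeg \<alpha>) has_sum K) multi_indices" "K \<le> B"
    "\<And>x. norm (x - x0) \<le> r \<Longrightarrow> ((\<lambda>\<alpha>. mpow (x - x0) \<alpha> *\<^sub>R c \<alpha>) has_sum f x) multi_indices"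
    by (rule power_series_boundE) blast
  have "((\<lambda>\<alpha>. mpow (x - x0) \<alpha> *\<^sub>R cnj (c \<alpha>)) has_sum cnj (f x)) multi_indices"
    if "norm (x - x0) \<le> r" for x
    using has_sum_bounded_linear[OF bounded_linear_cnj c(4)[OF that]] by simp
  then have "power_series_bound x0 r (\<lambda>x. cnj (f x)) B"
    unfolding power_series_bound_def using c by (intro conjI exI[of _ "\<lambda>\<alpha>. cnj (c \<alpha>)"] exI[of _ K]) auto
  then show ?thesis by (auto simp: analytic_germ_def)
qed

text \<open>Neumann series: f = f(x0) (1 - u) with u(x0) = 0, and on a small enough ball
  \<open>u\<close> has norm at most 1/2.\<close>

lemma analytic_germ_inverse [intro]:
  assumes "analytic_germ x0 f" "f x0 \<noteq> 0"
  shows "analytic_germ x0 (\<lambda>x. inverse (f x))"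
proof -
  define u where "u = (\<lambda>x. 1 - f x * inverse (f x0))"
  have "analytic_germ x0 u"
    unfolding u_def using assms(1) by (intro analytic_germ_diff analytic_germ_mult analytic_germ_const)
  then obtain r B where rB: "power_series_bound x0 r u B"
    by (auto simp: analytic_germ_def)
  then have r: "0 < r" by (simp add: power_series_bound_def)
  have "0 \<le> B" using power_series_bound_norm_le[OF rB, of x0] r by (auto intro: order_trans[OF norm_ge_zero])
  \<comment> \<open>Shrinking from r to s turns the bound B into B / (2 (B + 1)) \<le> 1/2; the
    summand 1 keeps the denominator positive when B = 0.\<close>
  define s where "s = r / (2 * (B + 1))"
  have "r * 1 \<le> r * (2 * (B + 1))" using r \<open>0 \<le> B\<close> by (intro mult_left_mono) auto
  then have s: "0 < s" "s \<le> r" using r \<open>0 \<le> B\<close> by (auto simp: s_def field_simps)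
  have "u x0 = 0" using assms by (simp add: u_def)
  then have "power_series_bound x0 s u (s / r * B)"
    using power_series_bound_shrink[OF rB s] by simp
  moreover have "s / r * B \<le> 1/2"
  proof -
    have "s / r * B = B / (2 * (B + 1))" using r by (simp add: s_def)
    also have "\<dots> \<le> 1 / 2" using \<open>0 \<le> B\<close> by (simp add: field_simps)
    finally show ?thesis .
  qed
  ultimately have half: "power_series_bound x0 s u (1/2)"
    by (rule power_series_bound_mono)
  have "power_series_bound x0 s (\<lambda>x. inverse (1 - u x)) 2"
  proof (rule power_series_bound_sum[where I = UNIV, OF s(1) power_series_bound_power[OF half]])
    show "((\<lambda>n. (1/2)^n) has_sum (2::real)) UNIV"
      using geometric_sums[of "1/2::real"] by (intro norm_summable_imp_has_sum) (auto simp: summable_geometric)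
    fix x assume "norm (x - x0) \<le> s"
    then have "norm (u x) < 1" using power_series_bound_norm_le[OF half] by fastforce
    then show "((\<lambda>n. u x ^ n) has_sum inverse (1 - u x)) UNIV"
      using geometric_sums[of "u x"]
      by (intro norm_summable_imp_has_sum) (auto simp: summable_geometric norm_power field_simps)
  qed
  then have "analytic_germ x0 (\<lambda>x. inverse (1 - u x))"
    by (auto simp: analytic_germ_def)
  then have "analytic_germ x0 (\<lambda>x. inverse (f x0) * inverse (1 - u x))"
    by (intro analytic_germ_mult analytic_germ_const)
  moreover have "inverse (f x0) * inverse (1 - u x) = inverse (f x)" for x
    using assms(2) by (simp add: u_def mult.left_commute)
  ultimately show ?thesis by simp
qed

text \<open>The formula for the inverse of \<open>T_vec\<close> holds only on the open image;
  agreement near the base point is enough for a germ.\<close>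

lemma analytic_germ_cong:
  assumes "analytic_germ x0 f" "open S" "x0 \<in> S" "\<And>x. x \<in> S \<Longrightarrow> f x = g x"
  shows "analytic_germ x0 g"
proof -
  obtain r B where rB: "power_series_bound x0 r f B"
    using assms by (auto simp: analytic_germ_def)
  then have "0 < r" by (simp add: power_series_bound_def)
  obtain e where e: "0 < e" "cball x0 e \<subseteq> S"
    using assms open_contains_cball by blast
  have "power_series_bound x0 (min e r) f B"
    using rB \<open>0 < r\<close> e by (auto intro: power_series_bound_radius_mono)
  moreover have "f x = g x" if "norm (x - x0) \<le> min e r" for x
    using that e assms(4) by (auto simp: subset_iff dist_norm norm_minus_commute)
  ultimately have "power_series_bound x0 (min e r) g B"
    by (auto simp: power_series_bound_def)
  then show ?thesis by (auto simp: analytic_germ_def)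
qed

text \<open>A coordinate function is a monomial of degree one centred at x0 plus a constant.\<close>

lemma analytic_germ_inner_Basis:
  assumes "b \<in> Basis"
  shows "analytic_germ x0 (\<lambda>x. of_real (x \<bullet> b))"
proof -
  let ?e = "restrict (\<lambda>b'. if b' = b then 1 else 0) Basis"
  have "(\<Prod>b'\<in>Basis. (y \<bullet> b') ^ ?e b') = (\<Prod>b'\<in>Basis. if b' = b then y \<bullet> b else 1)" for y :: 'a
    by (intro prod.cong) auto
  then have "mpow y ?e = y \<bullet> b" for y :: 'a
    using assms by (simp add: mpow_def)
  then have "power_series_bound x0 1 (\<lambda>x. ((x - x0) \<bullet> b) *\<^sub>R (1::complex)) (norm (1::complex) * 1 ^ mdeg ?e)"
    using power_series_bound_monomial[of 1 ?e x0 1] by simp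
  then have "analytic_germ x0 (\<lambda>x. ((x - x0) \<bullet> b) *\<^sub>R (1::complex))"
    by (auto simp: analytic_germ_def)
  then have "analytic_germ x0 (\<lambda>x. ((x - x0) \<bullet> b) *\<^sub>R (1::complex) + of_real (x0 \<bullet> b))"
    by auto
  then show ?thesis by (simp add: inner_diff_left scaleR_conv_of_real)
qed

lemma analytic_germ_linear:
  assumes "linear f"
  shows "analytic_germ x0 (f :: 'a::euclidean_space \<Rightarrow> complex)"
proof -
  have eq: "(\<Sum>b\<in>Basis. of_real (x \<bullet> b) * f b) = f x" for x
  proof -
    have "(\<Sum>b\<in>Basis. of_real (x \<bullet> b) * f b) = f (\<Sum>b\<in>Basis. (x \<bullet> b) *\<^sub>R b)"
      by (simp only: linear_sum[OF assms] linear_scale[OF assms] scaleR_conv_of_real)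
    then show ?thesis by (simp only: euclidean_representation)
  qed
  have "analytic_germ x0 (\<lambda>x. \<Sum>b\<in>Basis. of_real (x \<bullet> b) * f b)"
    by (intro analytic_germ_sum analytic_germ_mult analytic_germ_inner_Basis) auto
  then show ?thesis by (simp only: eq)
qed

lemma real_analytic_on_vecI:
  fixes f :: "'a::euclidean_space \<Rightarrow> complex ^ 'n"
  assumes "open S" "\<And>x i. x \<in> S \<Longrightarrow> analytic_germ x (\<lambda>y. f y $ i)"
  shows "f real_analytic_on S"
  unfolding real_analytic_on_def
proof (intro conjI ballI)
  fix x0 assume "x0 \<in> S"
  then have "\<forall>i. \<exists>r B. power_series_bound x0 r (\<lambda>y. f y $ i) B"
    using assms(2) by (simp add: analytic_germ_def)
  then obtain R B where RB: "\<And>i. power_series_bound x0 (R i) (\<lambda>y. f y $ i) (B i)" by metis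
  then have R: "0 < R i" for i by (simp add: power_series_bound_def)
  \<comment> \<open>There are finitely many components, so the least of their radii is still
    positive.\<close>
  define r where "r = Min (range R)"
  have r: "0 < r" using R by (simp add: r_def)
  have "power_series_bound x0 r (\<lambda>y. f y $ i) (B i)" for i
    using RB r by (rule power_series_bound_radius_mono) (simp add: r_def)
  then have "\<exists>c. \<forall>x. norm (x - x0) \<le> r \<longrightarrow>
      ((\<lambda>\<alpha>. mpow (x - x0) \<alpha> *\<^sub>R c \<alpha>) has_sum f x $ i) multi_indices" for i
    unfolding power_series_bound_def by blast
  then have "\<forall>i. \<exists>c. \<forall>x. norm (x - x0) \<le> r \<longrightarrow>
      ((\<lambda>\<alpha>. mpow (x - x0) \<alpha> *\<^sub>R c \<alpha>) has_sum f x $ i) multi_indices" ..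
  from choice[OF this] obtain c where c: "\<And>i x. norm (x - x0) \<le> r \<Longrightarrow>
      ((\<lambda>\<alpha>. mpow (x - x0) \<alpha> *\<^sub>R c i \<alpha>) has_sum f x $ i) multi_indices"
    by blast
  show "\<exists>r>0. \<exists>c. \<forall>x\<in>ball x0 r.
        ((\<lambda>\<alpha>. (\<Prod>b\<in>Basis. ((x - x0) \<bullet> b) ^ \<alpha> b) *\<^sub>R c \<alpha>) has_sum f x) multi_indices"
  proof (intro exI[of _ r] exI[of _ "\<lambda>\<alpha>. \<chi> i. c i \<alpha>"] conjI ballI r)
    fix x assume "x \<in> ball x0 r"
    then have x: "norm (x - x0) \<le> r" by (simp add: dist_norm norm_minus_commute)
    show "((\<lambda>\<alpha>. (\<Prod>b\<in>Basis. ((x - x0) \<bullet> b) ^ \<alpha> b) *\<^sub>R (\<chi> i. c i \<alpha>)) has_sum f x) multi_indices"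
      unfolding has_sum_def mpow_def[symmetric]
      by (rule vec_tendstoI) (use c[OF x] in \<open>simp add: has_sum_def\<close>)
  qed
qed fact

subsection \<open>The triangular structure of the parametrisation\<close>

lemma F_1 [simp]: "F (Suc 0) \<gamma> = \<gamma> 1"
  by (simp add: F.simps)

lemma F_rec:
  assumes "2 \<le> n"
  shows "F n \<gamma> = of_real (1 - (cmod (\<gamma> 1))\<^sup>2) * F (n - 1) (\<gamma> \<circ> Suc)
           - cnj (\<gamma> 1) * (\<Sum>k = 2..n - 1. F (n - k) (\<gamma> \<circ> Suc) * F k \<gamma>)"
  using assms by (subst F.simps) auto

lemma F_cong:
  "(\<And>j. j \<in> {1..n} \<Longrightarrow> \<gamma> j = \<delta> j) \<Longrightarrow> F n \<gamma> = F n \<delta>"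
proof (induction n arbitrary: \<gamma> \<delta> rule: less_induct)
  case (less n)
  show ?case
  proof (cases "2 \<le> n")
    case True
    have shifted: "F m (\<gamma> \<circ> Suc) = F m (\<delta> \<circ> Suc)" if "m < n" for m
      using that less.prems by (intro less.IH) auto
    have "(\<Sum>k = 2..n - 1. F (n - k) (\<gamma> \<circ> Suc) * F k \<gamma>) =
        (\<Sum>k = 2..n - 1. F (n - k) (\<delta> \<circ> Suc) * F k \<delta>)"
      using shifted less.prems by (intro sum.cong arg_cong2[of _ _ _ _ "(*)"] less.IH) auto
    moreover have "\<gamma> 1 = \<delta> 1" using less.prems True by auto
    ultimately show ?thesis
      using True shifted[of "n - 1"] unfolding F_rec[OF True] by simp
  next
    case False
    then consider "n = 0" | "n = 1" by linarith
    then show ?thesis using less.prems by cases (auto simp: F.simps)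
  qed
qed

text \<open>Only the term with F (n - 1) (\<gamma> \<circ> Suc) sees \<gamma>_n. In the sum k \<ge>
  2, so the shifted factor reaches at most the index n - k + 1 \<le> n - 1, and the other one at
  most k \<le> n - 1. Every level of the recursion contributes one factor 1 -
  |\<gamma>_j|^2.\<close>

lemma F_triangular:
  assumes "1 \<le> n"
  shows "F n \<gamma> = (\<Prod>j = 1..<n. of_real (1 - (cmod (\<gamma> j))\<^sup>2)) * \<gamma> n + F n (\<gamma>(n := 0))"
  using assms
proof (induction n arbitrary: \<gamma> rule: less_induct)
  case (less n)
  show ?case
  proof (cases "2 \<le> n")
    case True
    \<comment> \<open>The shift moves position n to n - 1, which is the last variable of F (n - 1),
      as the induction hypothesis expects.\<close>
    have upd: "(\<gamma>(n := 0)) \<circ> Suc = (\<gamma> \<circ> Suc)(n - 1 := 0)"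
      using True by (auto simp: fun_eq_iff)
    have IH: "F (n - 1) (\<gamma> \<circ> Suc) = (\<Prod>j = 1..<n - 1. of_real (1 - (cmod (\<gamma> (Suc j)))\<^sup>2)) * \<gamma> n
        + F (n - 1) ((\<gamma>(n := 0)) \<circ> Suc)"
    proof -
      have "F (n - 1) (\<gamma> \<circ> Suc) = (\<Prod>j = 1..<n - 1. of_real (1 - (cmod ((\<gamma> \<circ> Suc) j))\<^sup>2)) * (\<gamma> \<circ> Suc) (n - 1)
        + F (n - 1) ((\<gamma> \<circ> Suc)(n - 1 := 0))"
        using True by (intro less.IH) auto
      then show ?thesis unfolding upd using True by (simp only: o_apply) simp
    qed
    have prod: "(\<Prod>j = 1..<n. of_real (1 - (cmod (\<gamma> j))\<^sup>2)) =
        of_real (1 - (cmod (\<gamma> 1))\<^sup>2) * (\<Prod>j = 1..<n - 1. of_real (1 - (cmod (\<gamma> (Suc j)))\<^sup>2) :: complex)"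
    proof -
      have "{1..<n} = insert 1 {Suc 1..<Suc (n - 1)}" using True by auto
      moreover have "(\<Prod>j\<in>{Suc 1..<Suc (n - 1)}. of_real (1 - (cmod (\<gamma> j))\<^sup>2) :: complex) =
          (\<Prod>j = 1..<n - 1. of_real (1 - (cmod (\<gamma> (Suc j)))\<^sup>2))"
        by (rule prod.shift_bounds_Suc_ivl)
      ultimately show ?thesis by simp
    qed
    have S: "(\<Sum>k = 2..n - 1. F (n - k) (\<gamma> \<circ> Suc) * F k \<gamma>) =
        (\<Sum>k = 2..n - 1. F (n - k) ((\<gamma>(n := 0)) \<circ> Suc) * F k (\<gamma>(n := 0)))"
      using True by (intro sum.cong arg_cong2[of _ _ _ _ "(*)"] F_cong) auto
    have "F n \<gamma> = of_real (1 - (cmod (\<gamma> 1))\<^sup>2) * F (n - 1) (\<gamma> \<circ> Suc)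
           - cnj (\<gamma> 1) * (\<Sum>k = 2..n - 1. F (n - k) (\<gamma> \<circ> Suc) * F k \<gamma>)"
      by (rule F_rec[OF True])
    also have "\<dots> = (\<Prod>j = 1..<n. of_real (1 - (cmod (\<gamma> j))\<^sup>2)) * \<gamma> n +
       (of_real (1 - (cmod (\<gamma> 1))\<^sup>2) * F (n - 1) ((\<gamma>(n := 0)) \<circ> Suc)
           - cnj (\<gamma> 1) * (\<Sum>k = 2..n - 1. F (n - k) ((\<gamma>(n := 0)) \<circ> Suc) * F k (\<gamma>(n := 0))))"
      unfolding IH prod S by (simp only: algebra_simps)
    also have "of_real (1 - (cmod (\<gamma> 1))\<^sup>2) * F (n - 1) ((\<gamma>(n := 0)) \<circ> Suc)
           - cnj (\<gamma> 1) * (\<Sum>k = 2..n - 1. F (n - k) ((\<gamma>(n := 0)) \<circ> Suc) * F k (\<gamma>(n := 0))) = F n (\<gamma>(n := 0))"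
      using True by (simp add: F_rec)
    finally show ?thesis .
  next
    case False
    with less.prems show ?thesis by (auto simp: F.simps not_le numeral_2_eq_2 less_Suc_eq)
  qed
qed

text \<open>The case of a unimodular constant: the leading factor vanishes, and by induction so does
  each F k in the sum. It serves both the termination of Schur's algorithm and the failure of
  injectivity on the boundary.\<close>

lemma F_eq_0:
  assumes "cmod (\<gamma> 1) = 1" "2 \<le> n"
  shows "F n \<gamma> = 0"
  using assms(2)
proof (induction n rule: less_induct)
  case (less n)
  have "(\<Sum>k = 2..n - 1. F (n - k) (\<gamma> \<circ> Suc) * F k \<gamma>) = 0"
    using less.IH by (intro sum.neutral) auto
  then show ?case using less.prems assms(1) by (simp add: F_rec)
qed

section \<open>The functions Q and T\<close>

lemma Q_rec: "1 \<le> n \<Longrightarrow> Q n x = x n + (\<Sum>k = 1..n - 1. x (n - k) * Q k x)"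
  by (subst Q.simps) simp

lemma Q_cong: "(\<And>j. j \<in> {1..n} \<Longrightarrow> x j = y j) \<Longrightarrow> Q n x = Q n y"
proof (induction n rule: less_induct)
  case (less n)
  show ?case
  proof (cases "n = 0")
    case False
    have "x n = y n" using less.prems False by auto
    moreover have "(\<Sum>k = 1..n - 1. x (n - k) * Q k x) = (\<Sum>k = 1..n - 1. y (n - k) * Q k y)"
      using less.prems False by (intro sum.cong arg_cong2[of _ _ _ _ "(*)"] less.IH) auto
    ultimately show ?thesis using False by (simp add: Q_rec)
  qed (simp add: Q.simps)
qed

lemma T_cong: "(\<And>j. j \<in> {1..n} \<Longrightarrow> \<gamma> j = \<delta> j) \<Longrightarrow> T n \<gamma> = T n \<delta>"
  unfolding T_def by (intro Q_cong F_cong) auto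

lemma T_rec: "1 \<le> n \<Longrightarrow> T n \<gamma> = F n \<gamma> + (\<Sum>k = 1..n - 1. F (n - k) \<gamma> * T k \<gamma>)"
  unfolding T_def by (rule Q_rec)

text \<open>In the sum of \<open>T_rec\<close> both n - k and k are at most n - 1, so \<gamma>_n
  enters T n only through F n.\<close>

lemma T_triangular:
  assumes "1 \<le> n"
  shows "T n \<gamma> = (\<Prod>j = 1..<n. of_real (1 - (cmod (\<gamma> j))\<^sup>2)) * \<gamma> n + T n (\<gamma>(n := 0))"
proof -
  have "(\<Sum>k = 1..n - 1. F (n - k) \<gamma> * T k \<gamma>) = (\<Sum>k = 1..n - 1. F (n - k) (\<gamma>(n := 0)) * T k (\<gamma>(n := 0)))"
    by (intro sum.cong arg_cong2[of _ _ _ _ "(*)"] F_cong T_cong) auto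
  then show ?thesis
    using T_rec[OF assms, of \<gamma>] T_rec[OF assms, of "\<gamma>(n := 0)"] F_triangular[OF assms, of \<gamma>] by simp
qed

lemma prod_one_minus_norm_neq_0:
  fixes \<gamma> :: "nat \<Rightarrow> complex"
  assumes "\<And>j. j \<in> {1..<n} \<Longrightarrow> cmod (\<gamma> j) < 1"
  shows "(\<Prod>j = 1..<n. of_real (1 - (cmod (\<gamma> j))\<^sup>2) :: complex) \<noteq> 0"
proof -
  have "(cmod (\<gamma> j))\<^sup>2 < 1" if "j \<in> {1..<n}" for j
    using assms[OF that] by (simp add: abs_square_less_1)
  then have "1 - (cmod (\<gamma> j))\<^sup>2 \<noteq> 0" if "j \<in> {1..<n}" for j
    using that by fastforce
  then show ?thesis by (auto simp only: prod_zero_iff[OF finite_atLeastLessThan] of_real_eq_0_iff)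
qed

text \<open>The triangular system is solved from the first variable onwards. Its pivots involve only
  \<gamma>_j with j < m, and those of \<delta> agree with them by induction, so \<delta> may be any
  point; in the boundary argument it ranges over the closed polydisk.\<close>

lemma T_inj:
  assumes "\<And>k. k \<in> {1..m} \<Longrightarrow> T k \<gamma> = T k \<delta>" "\<And>j. j \<in> {1..<m} \<Longrightarrow> cmod (\<gamma> j) < 1" "k \<in> {1..m}"
  shows "\<gamma> k = \<delta> k"
  using assms(3)
proof (induction k rule: less_induct)
  case (less k)
  have eq: "\<gamma> j = \<delta> j" if "j \<in> {1..<k}" for j
    using that less by auto
  have "T k (\<gamma>(k := 0)) = T k (\<delta>(k := 0))"
    using eq by (intro T_cong) auto
  moreover have "(\<Prod>j = 1..<k. of_real (1 - (cmod (\<gamma> j))\<^sup>2)) = (\<Prod>j = 1..<k. of_real (1 - (cmod (\<delta> j))\<^sup>2) :: complex)"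
    using eq by (intro prod.cong) auto
  moreover have "T k \<gamma> = T k \<delta>" using assms(1) less.prems by auto
  moreover have "(\<Prod>j = 1..<k. of_real (1 - (cmod (\<gamma> j))\<^sup>2) :: complex) \<noteq> 0"
    using assms(2) less.prems by (intro prod_one_minus_norm_neq_0) auto
  ultimately show ?case
    using T_triangular[of k \<gamma>] T_triangular[of k \<delta>] less.prems by auto
qed

section \<open>Analyticity and continuity of F, Q and T\<close>

lemma analytic_germ_F:
  "(\<And>j. j \<in> {1..n} \<Longrightarrow> analytic_germ x0 (\<lambda>x. g x j)) \<Longrightarrow> analytic_germ x0 (\<lambda>x. F n (g x))"
proof (induction n arbitrary: g rule: less_induct)
  case (less n)
  show ?case
  proof (cases "2 \<le> n")
    case True
    have "analytic_germ x0 (\<lambda>x. F m (g x \<circ> Suc))" if "m < n" for m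
      using that less.prems by (intro less.IH) auto
    moreover have "analytic_germ x0 (\<lambda>x. F m (g x))" if "m < n" for m
      using that less.prems by (intro less.IH) auto
    moreover have "analytic_germ x0 (\<lambda>x. g x 1)" using less.prems True by auto
    \<comment> \<open>Writing |\<gamma>_1|^2 as \<gamma>_1 times its conjugate leaves only sums,
      products and conjugates.\<close>
    ultimately show ?thesis
      using True unfolding F_rec[OF True] of_real_diff complex_norm_square of_real_1
      by (intro analytic_germ_diff analytic_germ_mult analytic_germ_sum analytic_germ_cnj analytic_germ_const) auto
  next
    case False
    then consider "n = 0" | "n = 1" by linarith
    then show ?thesis using less.prems by cases (auto simp: F.simps)
  qed
qed

lemma analytic_germ_Q:
  "(\<And>j. j \<in> {1..n} \<Longrightarrow> analytic_germ x0 (\<lambda>x. g x j)) \<Longrightarrow> analytic_germ x0 (\<lambda>x. Q n (g x))"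
proof (induction n rule: less_induct)
  case (less n)
  show ?case
  proof (cases "n = 0")
    case False
    then have n: "1 \<le> n" by simp
    show ?thesis
      unfolding Q_rec[OF n] using n less
      by (intro analytic_germ_add analytic_germ_mult analytic_germ_sum) auto
  qed (auto simp: Q.simps)
qed

lemma analytic_germ_T:
  "(\<And>j. j \<in> {1..n} \<Longrightarrow> analytic_germ x0 (\<lambda>x. g x j)) \<Longrightarrow> analytic_germ x0 (\<lambda>x. T n (g x))"
  unfolding T_def by (intro analytic_germ_Q analytic_germ_F) auto

lemma continuous_on_F:
  "(\<And>j. j \<in> {1..n} \<Longrightarrow> continuous_on S (\<lambda>x. g x j)) \<Longrightarrow> continuous_on S (\<lambda>x. F n (g x))"
proof (induction n arbitrary: g rule: less_induct)
  case (less n)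
  show ?case
  proof (cases "2 \<le> n")
    case True
    have "continuous_on S (\<lambda>x. F m (g x \<circ> Suc))" if "m < n" for m
      using that less.prems by (intro less.IH) auto
    moreover have "continuous_on S (\<lambda>x. F m (g x))" if "m < n" for m
      using that less.prems by (intro less.IH) auto
    moreover have "continuous_on S (\<lambda>x. g x 1)" using less.prems True by auto
    ultimately show ?thesis
      using True unfolding F_rec[OF True] by (intro continuous_intros) auto
  next
    case False
    then consider "n = 0" | "n = 1" by linarith
    then show ?thesis using less.prems by cases (auto simp: F.simps)
  qed
qed

lemma continuous_on_Q:
  "(\<And>j. j \<in> {1..n} \<Longrightarrow> continuous_on S (\<lambda>x. g x j)) \<Longrightarrow> continuous_on S (\<lambda>x. Q n (g x))"
proof (induction n rule: less_induct)
  case (less n)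
  show ?case
  proof (cases "n = 0")
    case False
    then have n: "1 \<le> n" by simp
    show ?thesis
      unfolding Q_rec[OF n] using n less by (intro continuous_intros) auto
  qed (auto simp: Q.simps)
qed

lemma continuous_on_T:
  "(\<And>j. j \<in> {1..n} \<Longrightarrow> continuous_on S (\<lambda>x. g x j)) \<Longrightarrow> continuous_on S (\<lambda>x. T n (g x))"
  unfolding T_def by (intro continuous_on_Q continuous_on_F) auto

subsection \<open>Schur's algorithm\<close>

text \<open>F k is the coefficient of z^(k-1). Cleared of denominators, a Schur step reads A_(l+1) +
  cnj \<gamma>_1 (A B)_l = B_l. The summand A_0 B_l = \<gamma>_1 B_l of the convolution combines
  with B_l to (1 - |\<gamma>_1|^2) B_l; this is why the sum in the recursion of F starts at
  2.\<close>

lemma fps_nth_schur_step: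
  fixes A B :: "complex fps"
  assumes eq: "A * (1 + fps_const (cnj (\<gamma> 1)) * (fps_X * B)) = fps_const (\<gamma> 1) + fps_X * B"
    and B: "\<And>k. k \<in> {1..n} \<Longrightarrow> fps_nth B (k - 1) = F k (\<gamma> \<circ> Suc)"
    and k: "k \<in> {1..Suc n}"
  shows "fps_nth A (k - 1) = F k \<gamma>"
  using k
proof (induction k rule: less_induct)
  case (less k)
  show ?case
  proof (cases "k = 1")
    case True
    then show ?thesis using arg_cong[OF eq, of "\<lambda>f. fps_nth f 0"] by simp
  next
    case False
    with less.prems have k: "2 \<le> k" "k \<le> Suc n" by auto
    define l where "l = k - 2"
    have l: "k = Suc (Suc l)" using k by (simp add: l_def)
    have k1: "k - 1 = Suc l" using l by simp
    define S where "S = (\<Sum>j = 2..Suc l. F (k - j) (\<gamma> \<circ> Suc) * F j \<gamma>)"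
    have "A * (1 + fps_const (cnj (\<gamma> 1)) * (fps_X * B)) = A + fps_const (cnj (\<gamma> 1)) * (fps_X * (A * B))"
      by (simp add: algebra_simps)
    with eq have "A + fps_const (cnj (\<gamma> 1)) * (fps_X * (A * B)) = fps_const (\<gamma> 1) + fps_X * B"
      by (simp only:)
    from arg_cong[OF this, of "\<lambda>f. fps_nth f (Suc l)"]
    have "fps_nth A (Suc l) + cnj (\<gamma> 1) * fps_nth (A * B) l = fps_nth B l"
      by simp
    moreover have "fps_nth (A * B) l = \<gamma> 1 * F (Suc l) (\<gamma> \<circ> Suc) + (\<Sum>j = 2..Suc l. F (k - j) (\<gamma> \<circ> Suc) * F j \<gamma>)"
    proof -
      have "fps_nth (A * B) l = (\<Sum>i=0..l. fps_nth A (Suc i - 1) * fps_nth B (l - i))"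
        by (simp add: fps_mult_nth)
      also have "\<dots> = (\<Sum>i=0..l. F (Suc i) \<gamma> * F (k - Suc i) (\<gamma> \<circ> Suc))"
      proof (intro sum.cong arg_cong2[of _ _ _ _ "(*)"] refl)
        fix i assume i: "i \<in> {0..l}"
        show "fps_nth A (Suc i - 1) = F (Suc i) \<gamma>"
          using i k l by (intro less.IH) auto
        show "fps_nth B (l - i) = F (k - Suc i) (\<gamma> \<circ> Suc)"
          using B[of "k - Suc i"] i k l by (simp add: Suc_diff_le)
      qed
      also have "\<dots> = (\<Sum>j=Suc 0..Suc l. F j \<gamma> * F (k - j) (\<gamma> \<circ> Suc))"
        by (rule sum.shift_bounds_cl_Suc_ivl[symmetric])
      also have "\<dots> = \<gamma> 1 * F (Suc l) (\<gamma> \<circ> Suc) + (\<Sum>j = 2..Suc l. F j \<gamma> * F (k - j) (\<gamma> \<circ> Suc))"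
        using l by (subst sum.atLeast_Suc_atMost) (auto simp: numeral_2_eq_2)
      finally show ?thesis by (simp add: mult.commute)
    qed
    moreover have "fps_nth B l = F (Suc l) (\<gamma> \<circ> Suc)"
      using B[of "Suc l"] k l by simp
    ultimately have "fps_nth A (Suc l) = F (Suc l) (\<gamma> \<circ> Suc) - cnj (\<gamma> 1) * (\<gamma> 1 * F (Suc l) (\<gamma> \<circ> Suc) + S)"
      unfolding S_def by (simp only: eq_diff_eq)
    moreover have "F k \<gamma> = (1 - \<gamma> 1 * cnj (\<gamma> 1)) * F (Suc l) (\<gamma> \<circ> Suc) - cnj (\<gamma> 1) * S"
      unfolding S_def F_rec[OF k(1)] of_real_diff complex_norm_square of_real_1 by (simp only: k1)
    moreover have "F (Suc l) (\<gamma> \<circ> Suc) - cnj (\<gamma> 1) * (\<gamma> 1 * F (Suc l) (\<gamma> \<circ> Suc) + S) =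
        (1 - \<gamma> 1 * cnj (\<gamma> 1)) * F (Suc l) (\<gamma> \<circ> Suc) - cnj (\<gamma> 1) * S"
      by (simp add: algebra_simps)
    ultimately show ?thesis by (simp only: k1)
  qed
qed

text \<open>The factor 2 arises because A_(k-1) occurs twice, on the right-hand side and as G_0
  A_(k-1) with G_0 = 1. The other convolution terms reproduce the recursion of \<open>Q\<close> at
  the values of \<open>F\<close>.\<close>

lemma fps_nth_caratheodory_step:
  fixes A G :: "complex fps"
  assumes eq: "G * (1 - fps_X * A) = 1 + fps_X * A"
    and A: "\<And>k. k \<in> {1..n} \<Longrightarrow> fps_nth A (k - 1) = F k \<gamma>"
    and k: "k \<in> {1..n}"
  shows "fps_nth G k = 2 * T k \<gamma>"
  using k
proof (induction k rule: less_induct)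
  case (less k)
  then obtain l where l: "k = Suc l" by (cases k) auto
  have G0: "fps_nth G 0 = 1"
    using arg_cong[OF eq, of "\<lambda>f. fps_nth f 0"] by simp
  have "G * (1 - fps_X * A) = G - fps_X * (G * A)"
    by (simp add: algebra_simps)
  with eq have "G - fps_X * (G * A) = 1 + fps_X * A" by (simp only:)
  from arg_cong[OF this, of "\<lambda>f. fps_nth f (Suc l)"]
  have "fps_nth G k - fps_nth (G * A) l = fps_nth A l" by (simp add: l)
  moreover have "fps_nth (G * A) l = F k \<gamma> + 2 * (\<Sum>j = 1..l. F (k - j) \<gamma> * T j \<gamma>)"
  proof -
    have "fps_nth (G * A) l = fps_nth G 0 * fps_nth A l + (\<Sum>i = Suc 0..l. fps_nth G i * fps_nth A (l - i))"
      by (simp add: fps_mult_nth sum.atLeast_Suc_atMost)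
    also have "(\<Sum>i = Suc 0..l. fps_nth G i * fps_nth A (l - i)) = (\<Sum>i = Suc 0..l. (2 * T i \<gamma>) * F (k - i) \<gamma>)"
    proof (intro sum.cong arg_cong2[of _ _ _ _ "(*)"] refl)
      fix i assume i: "i \<in> {Suc 0..l}"
      show "fps_nth G i = 2 * T i \<gamma>" using i l less by auto
      show "fps_nth A (l - i) = F (k - i) \<gamma>"
        using A[of "k - i"] i less.prems l by (auto simp: Suc_diff_le)
    qed
    finally show ?thesis
      using A[of k] less.prems l by (simp add: G0 sum_distrib_left mult_ac)
  qed
  moreover have "fps_nth A l = F k \<gamma>" using A[of k] less.prems l by simp
  moreover have "T k \<gamma> = F k \<gamma> + (\<Sum>j = 1..l. F (k - j) \<gamma> * T j \<gamma>)"
    using T_rec[of k \<gamma>] l by simp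
  ultimately show ?case by (simp add: algebra_simps)
qed

section \<open>The Schur class and its parameters\<close>

definition schur_class :: "(complex \<Rightarrow> complex) set" where
  "schur_class = {f. f holomorphic_on ball 0 1 \<and> (\<forall>z\<in>ball 0 1. cmod (f z) \<le> 1)}"

lemma has_fps_expansion_unit_disc:
  "f holomorphic_on ball 0 1 \<Longrightarrow> f has_fps_expansion fps_expansion f 0"
  by (rule has_fps_expansion_fps_expansion[of "ball 0 1"]) auto

text \<open>This carries functional equations on the disc over to the formal identities used in the
  coefficient comparisons.\<close>

lemma fps_eq_of_unit_disc:
  fixes f g :: "complex \<Rightarrow> complex"
  assumes "f has_fps_expansion A" "g has_fps_expansion B" "\<And>z. z \<in> ball 0 1 \<Longrightarrow> f z = g z"
  shows "A = B"
proof -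
  have "eventually (\<lambda>z::complex. z \<in> ball 0 1) (nhds 0)"
    by (intro eventually_nhds_in_open) auto
  then have "eventually (\<lambda>z. f z = g z) (nhds 0)"
    by eventually_elim (rule assms)
  then have "f has_fps_expansion B"
    using assms(2) by (subst has_fps_expansion_cong) auto
  with assms(1) show ?thesis by (rule fps_expansion_unique_complex)
qed

lemma fps_expansion_schur_step:
  assumes f: "f holomorphic_on ball 0 1" and g: "g holomorphic_on ball 0 1"
    and eq: "\<And>z. z \<in> ball 0 1 \<Longrightarrow> f z * (1 + cnj c * (z * g z)) = c + z * g z"
  shows "fps_expansion f 0 * (1 + fps_const (cnj c) * (fps_X * fps_expansion g 0)) =
    fps_const c + fps_X * fps_expansion g 0"
proof (rule fps_eq_of_unit_disc[OF _ _ eq])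
  note A = has_fps_expansion_unit_disc[OF f] and B = has_fps_expansion_unit_disc[OF g]
  show "(\<lambda>z. f z * (1 + cnj c * (z * g z))) has_fps_expansion
      fps_expansion f 0 * (1 + fps_const (cnj c) * (fps_X * fps_expansion g 0))"
    by (intro has_fps_expansion_mult has_fps_expansion_add has_fps_expansion_const
        has_fps_expansion_1 has_fps_expansion_fps_X A B)
  show "(\<lambda>z. c + z * g z) has_fps_expansion fps_const c + fps_X * fps_expansion g 0"
    by (intro has_fps_expansion_mult has_fps_expansion_add has_fps_expansion_const
        has_fps_expansion_fps_X B)
qed

text \<open>The sign of the right-hand side decides whether (c + w)/(1 + cnj c * w) has modulus at
  most 1 or less than 1; both estimates are read off below.\<close>

lemma norm_sq_mobius_diff:
  "(cmod (1 + cnj c * w))\<^sup>2 - (cmod (c + w))\<^sup>2 = (1 - (cmod c)\<^sup>2) * (1 - (cmod w)\<^sup>2)"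
proof -
  \<comment> \<open>Over the complex numbers a squared modulus is z times cnj z, and the claim
    becomes a polynomial identity.\<close>
  have "complex_of_real ((cmod (1 + cnj c * w))\<^sup>2 - (cmod (c + w))\<^sup>2) =
      complex_of_real ((1 - (cmod c)\<^sup>2) * (1 - (cmod w)\<^sup>2))"
    by (simp only: of_real_diff of_real_mult of_real_1 complex_norm_square) (simp add: algebra_simps)
  then show ?thesis by (simp only: of_real_eq_iff)
qed

lemma norm_mobius_le:
  assumes "cmod c \<le> 1" "cmod w \<le> 1"
  shows "cmod (c + w) \<le> cmod (1 + cnj c * w)"
proof -
  have "0 \<le> (1 - (cmod c)\<^sup>2) * (1 - (cmod w)\<^sup>2)"
    using assms by (intro mult_nonneg_nonneg) (auto simp: abs_square_le_1)
  then have "(cmod (c + w))\<^sup>2 \<le> (cmod (1 + cnj c * w))\<^sup>2"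
    using norm_sq_mobius_diff[of c w] by linarith
  then show ?thesis by (rule power2_le_imp_le) simp
qed

lemma norm_mobius_less:
  assumes "cmod c < 1" "cmod w < 1"
  shows "cmod (c + w) < cmod (1 + cnj c * w)"
proof -
  have "0 < (1 - (cmod c)\<^sup>2) * (1 - (cmod w)\<^sup>2)"
    using assms by (intro mult_pos_pos) (auto simp: abs_square_less_1)
  then have "(cmod (c + w))\<^sup>2 < (cmod (1 + cnj c * w))\<^sup>2"
    using norm_sq_mobius_diff[of c w] by linarith
  then show ?thesis by (rule power2_less_imp_less) simp
qed

lemma norm_mult_schur_less:
  assumes "f \<in> schur_class" "z \<in> ball 0 1"
  shows "cmod (z * f z) < 1"
proof -
  have "cmod (z * f z) \<le> cmod z * 1"
    unfolding norm_mult using assms by (intro mult_left_mono) (auto simp: schur_class_def)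
  also have "\<dots> < 1" using assms by simp
  finally show ?thesis .
qed

lemma one_plus_mult_neq_0:
  assumes "cmod c \<le> 1" "cmod w < 1"
  shows "1 + c * w \<noteq> 0"
proof
  assume "1 + c * w = 0"
  then have "c * w = - 1" by (rule minus_unique[symmetric])
  then have "cmod (c * w) = 1" by (simp only: norm_minus_cancel norm_one)
  moreover have "cmod c * cmod w \<le> 1 * cmod w" using assms by (intro mult_right_mono) auto
  ultimately show False using assms by (simp add: norm_mult)
qed

text \<open>Schur's algorithm run backwards from the function 0. A unimodular \<gamma>_1 fits in: |z
  * g z| < 1 keeps the denominator nonzero, and the fraction collapses to the constant
  \<gamma>_1.\<close>

lemma schur_class_of_parameters:
  assumes "\<And>j. j \<in> {1..n} \<Longrightarrow> cmod (\<gamma> j) \<le> 1"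
  shows "\<exists>f\<in>schur_class. \<forall>k\<in>{1..n}. fps_nth (fps_expansion f 0) (k - 1) = F k \<gamma>"
  using assms
proof (induction n arbitrary: \<gamma>)
  case 0
  have "(\<lambda>_. 0) \<in> schur_class" by (simp add: schur_class_def)
  then show ?case by auto
next
  case (Suc n)
  define c where "c = \<gamma> 1"
  have c: "cmod c \<le> 1" using Suc.prems by (simp add: c_def)
  have "\<exists>g\<in>schur_class. \<forall>k\<in>{1..n}. fps_nth (fps_expansion g 0) (k - 1) = F k (\<gamma> \<circ> Suc)"
    using Suc.prems by (intro Suc.IH) auto
  then obtain g where g: "g \<in> schur_class" "\<forall>k\<in>{1..n}. fps_nth (fps_expansion g 0) (k - 1) = F k (\<gamma> \<circ> Suc)"
    by blast
  define f where "f = (\<lambda>z. (c + z * g z) / (1 + cnj c * (z * g z)))"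
  have g_hol: "g holomorphic_on ball 0 1" using g by (simp add: schur_class_def)
  have nz: "1 + cnj c * (z * g z) \<noteq> 0" if "z \<in> ball 0 1" for z
    using c norm_mult_schur_less[OF g(1) that] by (intro one_plus_mult_neq_0) auto
  have f_hol: "f holomorphic_on ball 0 1"
    unfolding f_def using nz by (intro holomorphic_intros g_hol) auto
  have "cmod (f z) \<le> 1" if "z \<in> ball 0 1" for z
    using norm_mobius_le[OF c, of "z * g z"] norm_mult_schur_less[OF g(1) that] nz[OF that]
    by (simp add: f_def norm_divide)
  with f_hol have "f \<in> schur_class" by (simp add: schur_class_def)
  moreover have "fps_nth (fps_expansion f 0) (k - 1) = F k \<gamma>" if "k \<in> {1..Suc n}" for k
  proof (rule fps_nth_schur_step[OF _ _ that])
    show "fps_expansion f 0 * (1 + fps_const (cnj (\<gamma> 1)) * (fps_X * fps_expansion g 0)) =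
      fps_const (\<gamma> 1) + fps_X * fps_expansion g 0"
      unfolding c_def[symmetric] using nz
      by (intro fps_expansion_schur_step f_hol g_hol) (simp add: f_def)
  qed (use g in auto)
  ultimately show ?case by blast
qed

text \<open>By the maximum modulus principle. In the first case Schur's algorithm stops; in the
  second it can make another step.\<close>

lemma schur_class_const_or_less:
  assumes f: "f \<in> schur_class"
  shows "(\<exists>c. cmod c = 1 \<and> (\<forall>z\<in>ball 0 1. f z = c)) \<or> (\<forall>z\<in>ball 0 1. cmod (f z) < 1)"
proof (cases "\<forall>z\<in>ball 0 1. cmod (f z) < 1")
  case False
  then obtain \<xi> where \<xi>: "\<xi> \<in> ball 0 1" "cmod (f \<xi>) = 1"
    using f by (force simp: schur_class_def)
  have "f constant_on ball 0 1"
    by (rule maximum_modulus_principle[of f "ball 0 1" "ball 0 1" \<xi>])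
       (use f \<xi> in \<open>auto simp: schur_class_def\<close>)
  then show ?thesis using \<xi> unfolding constant_on_def by metis
qed auto

text \<open>Schwarz's lemma keeps the quotient of Schur's algorithm in the class.\<close>

lemma schur_algorithm_step:
  assumes f: "f \<in> schur_class" and less: "\<And>z. z \<in> ball 0 1 \<Longrightarrow> cmod (f z) < 1"
  obtains g where "g \<in> schur_class"
    "\<And>z. z \<in> ball 0 1 \<Longrightarrow> f z * (1 + cnj (f 0) * (z * g z)) = f 0 + z * g z"
proof -
  define c where "c = f 0"
  have c: "cmod c < 1" using less by (simp add: c_def)
  have f_hol: "f holomorphic_on ball 0 1" using f by (simp add: schur_class_def)
  define h where "h = (\<lambda>z. (f z - c) / (1 - cnj c * f z))"
  have nz: "1 - cnj c * f z \<noteq> 0" if "z \<in> ball 0 1" for z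
    using one_plus_mult_neq_0[of "- cnj c" "f z"] c less[OF that] by simp
  have h_hol: "h holomorphic_on ball 0 1"
    unfolding h_def using nz by (intro holomorphic_intros f_hol) auto
  have h_less: "cmod (h z) < 1" if "cmod z < 1" for z
  proof -
    have "cmod (- c + f z) < cmod (1 + cnj (- c) * f z)"
      using c less[of z] that by (intro norm_mobius_less) auto
    then show ?thesis using nz[of z] that by (simp add: h_def norm_divide divide_simps)
  qed
  have h0: "h 0 = 0" by (simp add: h_def c_def)
  obtain g where g: "g holomorphic_on ball 0 1" "\<And>z. cmod z < 1 \<Longrightarrow> h z = z * g z" "deriv h 0 = g 0"
    using Schwarz3[OF h_hol h0] by blast
  have "cmod (g z) \<le> 1" if "z \<in> ball 0 1" for z
  proof (cases "z = 0")
    case True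
    then show ?thesis using Schwarz_Lemma(2)[OF h_hol h0 h_less, of 0] g by simp
  next
    case False
    have "cmod z * cmod (g z) \<le> cmod z * 1"
      using Schwarz_Lemma(1)[OF h_hol h0 h_less, of z] that g(2)[of z] by (simp add: norm_mult)
    then show ?thesis using False by simp
  qed
  with g have "g \<in> schur_class" by (simp add: schur_class_def)
  moreover have "f z * (1 + cnj c * (z * g z)) = c + z * g z" if "z \<in> ball 0 1" for z
  proof -
    have "h z * (1 - cnj c * f z) = f z - c" using nz[OF that] by (simp add: h_def)
    then show ?thesis using g(2)[of z] that by (simp add: algebra_simps)
  qed
  ultimately show ?thesis using that unfolding c_def by blast
qed

text \<open>Schur's algorithm run forwards: f 0 is put in front of the parameters of the quotient,
  and a unimodular constant ends the process.\<close>

lemma parameters_of_schur_class: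
  assumes "f \<in> schur_class"
  shows "\<exists>\<gamma>. (\<forall>j. cmod (\<gamma> j) \<le> 1) \<and> (\<forall>k\<in>{1..n}. fps_nth (fps_expansion f 0) (k - 1) = F k \<gamma>)"
  using assms
proof (induction n arbitrary: f)
  case 0
  then show ?case by (intro exI[of _ "\<lambda>_. 0"]) auto
next
  case (Suc n)
  then consider c where "cmod c = 1" "\<forall>z\<in>ball 0 1. f z = c" | "\<forall>z\<in>ball 0 1. cmod (f z) < 1"
    using schur_class_const_or_less by blast
  then show ?case
  proof cases
    case 1
    \<comment> \<open>By \<open>F_eq_0\<close> the parameters after a unimodular one have no
      influence; 0 is an arbitrary choice in the disc.\<close>
    let ?\<gamma> = "\<lambda>j::nat. if j = 1 then c else 0"
    have "fps_expansion f 0 = fps_const c"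
      using 1 Suc.prems
      by (intro fps_eq_of_unit_disc[OF has_fps_expansion_unit_disc has_fps_expansion_const])
         (auto simp: schur_class_def)
    moreover have "fps_nth (fps_const c) (k - 1) = F k ?\<gamma>" if "k \<in> {1..Suc n}" for k
      using F_eq_0[of ?\<gamma> k] that 1(1) by (cases "k = 1") auto
    ultimately show ?thesis using 1(1) by (intro exI[of _ ?\<gamma>]) auto
  next
    case 2
    then obtain g where g: "g \<in> schur_class"
      "\<And>z. z \<in> ball 0 1 \<Longrightarrow> f z * (1 + cnj (f 0) * (z * g z)) = f 0 + z * g z"
      using schur_algorithm_step[OF Suc.prems] by blast
    obtain \<delta> where \<delta>: "\<And>j. cmod (\<delta> j) \<le> 1" "\<And>k. k \<in> {1..n} \<Longrightarrow> fps_nth (fps_expansion g 0) (k - 1) = F k \<delta>"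
      using Suc.IH[OF g(1)] by blast
    define \<gamma> where "\<gamma> = (\<lambda>j. if j = 1 then f 0 else \<delta> (j - 1))"
    have "fps_nth (fps_expansion f 0) (k - 1) = F k \<gamma>" if "k \<in> {1..Suc n}" for k
    proof (rule fps_nth_schur_step[OF _ _ that])
      show "fps_expansion f 0 * (1 + fps_const (cnj (\<gamma> 1)) * (fps_X * fps_expansion g 0)) =
        fps_const (\<gamma> 1) + fps_X * fps_expansion g 0"
        using fps_expansion_schur_step[OF _ _ g(2)] Suc.prems g(1)
        by (simp add: schur_class_def \<gamma>_def)
      fix k assume "k \<in> {1..n}"
      then show "fps_nth (fps_expansion g 0) (k - 1) = F k (\<gamma> \<circ> Suc)"
        using \<delta>(2) by (auto simp: \<gamma>_def intro!: F_cong)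
    qed
    moreover have "cmod (\<gamma> j) \<le> 1" for j
      using \<delta>(1) 2 by (auto simp: \<gamma>_def less_imp_le)
    ultimately show ?thesis by blast
  qed
qed

section \<open>The Cayley transform between the Schur and Caratheodory classes\<close>

lemma caratheodory_of_schur:
  assumes "f \<in> schur_class"
  obtains g where "g \<in> caratheodory" "\<And>z. z \<in> ball 0 1 \<Longrightarrow> g z * (1 - z * f z) = 1 + z * f z"
proof -
  define g where "g = (\<lambda>z. (1 + z * f z) / (1 - z * f z))"
  have f_hol: "f holomorphic_on ball 0 1" using assms by (simp add: schur_class_def)
  have nz: "1 - z * f z \<noteq> 0" if "z \<in> ball 0 1" for z
    using one_plus_mult_neq_0[of "- 1" "z * f z"] norm_mult_schur_less[OF assms that] by simp
  have "g holomorphic_on ball 0 1"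
    unfolding g_def using nz by (intro holomorphic_intros f_hol) auto
  moreover have "0 < Re (g z)" if "z \<in> ball 0 1" for z
  proof -
    define w where "w = z * f z"
    have w: "(cmod w)\<^sup>2 < 1" using norm_mult_schur_less[OF assms that] by (simp add: w_def abs_square_less_1)
    have "1 - w \<noteq> 0" using nz[OF that] by (simp add: w_def)
    \<comment> \<open>This is the reason the Cayley transform sends the disc to the right
      half-plane.\<close>
    have "Re ((1 + w) / (1 - w)) = (1 - (cmod w)\<^sup>2) / (cmod (1 - w))\<^sup>2"
      unfolding Re_complex_div_eq_0 Re_divide cmod_power2
      by (simp add: power2_eq_square algebra_simps)
    also have "\<dots> > 0" using w \<open>1 - w \<noteq> 0\<close> by (intro divide_pos_pos) auto
    finally show ?thesis by (simp add: g_def w_def)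
  qed
  ultimately have "g \<in> caratheodory" by (simp add: caratheodory_def g_def)
  then show ?thesis using that nz by (simp add: g_def)
qed

text \<open>The inverse Cayley transform sends the half-plane to the disc and g 0 = 1 to 0, so by
  Schwarz's lemma division by z leads into the Schur class.\<close>

lemma schur_of_caratheodory:
  assumes "g \<in> caratheodory"
  obtains f where "f \<in> schur_class" "\<And>z. z \<in> ball 0 1 \<Longrightarrow> g z * (1 - z * f z) = 1 + z * f z"
proof -
  define h where "h = (\<lambda>z. (g z - 1) / (g z + 1))"
  have g: "g holomorphic_on ball 0 1" "g 0 = 1" "\<And>z. z \<in> ball 0 1 \<Longrightarrow> 0 < Re (g z)"
    using assms by (auto simp: caratheodory_def)
  have nz: "g z + 1 \<noteq> 0" if "z \<in> ball 0 1" for z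
    using g(3)[OF that] by (auto simp: complex_eq_iff)
  have h_hol: "h holomorphic_on ball 0 1"
    unfolding h_def using nz by (intro holomorphic_intros g) auto
  have h0: "h 0 = 0" using g by (simp add: h_def)
  have h_less: "cmod (h z) < 1" if "cmod z < 1" for z
  proof -
    \<comment> \<open>The difference of the two sides is 4 Re (g z).\<close>
    have "(cmod (g z - 1))\<^sup>2 < (cmod (g z + 1))\<^sup>2"
      using g(3)[of z] that unfolding cmod_power2 by (simp add: power2_eq_square algebra_simps)
    then have "cmod (g z - 1) < cmod (g z + 1)" by (rule power2_less_imp_less) simp
    then show ?thesis using nz[of z] that by (simp add: h_def norm_divide divide_simps)
  qed
  obtain f where f: "f holomorphic_on ball 0 1" "\<And>z. cmod z < 1 \<Longrightarrow> h z = z * f z" "deriv h 0 = f 0"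
    using Schwarz3[OF h_hol h0] by blast
  \<comment> \<open>At the origin the quotient equals the derivative of \<open>h\<close>, so the
    derivative part of Schwarz's lemma is used there and the growth part elsewhere.\<close>
  have "cmod (f z) \<le> 1" if "z \<in> ball 0 1" for z
  proof (cases "z = 0")
    case True
    then show ?thesis using Schwarz_Lemma(2)[OF h_hol h0 h_less, of 0] f by simp
  next
    case False
    have "cmod z * cmod (f z) \<le> cmod z * 1"
      using Schwarz_Lemma(1)[OF h_hol h0 h_less, of z] that f(2)[of z] by (simp add: norm_mult)
    then show ?thesis using False by simp
  qed
  with f have "f \<in> schur_class" by (simp add: schur_class_def)
  moreover have "g z * (1 - z * f z) = 1 + z * f z" if "z \<in> ball 0 1" for z
  proof -
    have "h z * (g z + 1) = g z - 1" using nz[OF that] by (simp add: h_def)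
    then show ?thesis using f(2)[of z] that by (simp add: algebra_simps)
  qed
  ultimately show ?thesis using that by blast
qed

text \<open>This turns the O-condition of \<open>coefficient_body\<close> into equations between
  Taylor coefficients.\<close>

lemma bigo_taylor_iff:
  fixes f :: "complex \<Rightarrow> complex"
  assumes f: "f has_fps_expansion A"
  shows "(\<lambda>z. f z - (\<Sum>k\<le>n. a k * z ^ k)) \<in> O[at 0](\<lambda>z. z ^ Suc n) \<longleftrightarrow> (\<forall>k\<le>n. fps_nth A k = a k)"
proof -
  define P where "P = (\<Sum>k\<le>n. fps_const (a k) * fps_X ^ k)"
  define D where "D = A - P"
  define d where "d = (\<lambda>z. f z - (\<Sum>k\<le>n. a k * z ^ k))"
  have d: "d has_fps_expansion D"
    unfolding d_def D_def P_def
    by (intro has_fps_expansion_diff has_fps_expansion_sum has_fps_expansion_mult has_fps_expansion_const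
        has_fps_expansion_fps_X_power f)
  have "fps_nth P k = (\<Sum>j\<le>n. if j = k then a j else 0)" for k
    unfolding P_def fps_sum_nth fps_mult_left_const_nth fps_X_power_nth by (intro sum.cong) auto
  then have P: "fps_nth P k = (if k \<le> n then a k else 0)" for k by simp
  have "d \<in> O[at 0](\<lambda>z. z ^ Suc n) \<longleftrightarrow> (\<forall>k\<le>n. fps_nth D k = 0)"
  proof
    assume O: "d \<in> O[at 0](\<lambda>z. z ^ Suc n)"
    show "\<forall>k\<le>n. fps_nth D k = 0"
    proof (rule ccontr)
      assume "\<not> (\<forall>k\<le>n. fps_nth D k = 0)"
      then obtain k where "k \<le> n" "fps_nth D k \<noteq> 0" by blast
      \<comment> \<open>The quotient d(z)/z^m tends to a nonzero coefficient, whereas O(z^(n+1))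
        with m \<le> n would force the limit 0.\<close>
      define m where "m = subdegree D"
      have "m \<le> n" using subdegree_leI[OF \<open>fps_nth D k \<noteq> 0\<close>] \<open>k \<le> n\<close> by (simp add: m_def)
      have "fps_nth D m \<noteq> 0" using \<open>fps_nth D k \<noteq> 0\<close> by (auto simp: m_def)
      have ev: "\<forall>\<^sub>F z in at 0. z \<noteq> (0::complex)"
        by (rule eventually_at_topological[THEN iffD2]) auto
      have "((\<lambda>z. z ^ (Suc n - m)) \<longlongrightarrow> (0::complex) ^ (Suc n - m)) (at 0)"
        by (intro tendsto_power tendsto_ident_at)
      then have lim: "((\<lambda>z. z ^ (Suc n - m)) \<longlongrightarrow> (0::complex)) (at 0)"
        using \<open>m \<le> n\<close> by (simp add: power_0_left)
      have "\<forall>\<^sub>F z::complex in at 0. z ^ (Suc n - m) = z ^ Suc n / z ^ m"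
        using ev by (rule eventually_mono) (use \<open>m \<le> n\<close> in \<open>auto intro!: power_diff simp del: power_Suc\<close>)
      from Lim_transform_eventually[OF lim this]
      have "(\<lambda>z::complex. z ^ Suc n) \<in> o[at 0](\<lambda>z. z ^ m)"
        by (rule smalloI_tendsto) (rule eventually_mono[OF ev], simp)
      with O have "d \<in> o[at 0](\<lambda>z. z ^ m)" by (rule landau_o.big_small_trans)
      then have lim0: "((\<lambda>z. d z / z ^ m) \<longlongrightarrow> 0) (at 0)" by (rule smalloD_tendsto)
      have "isCont (\<lambda>z. if z = 0 then fps_nth D m else d z / z ^ m) 0"
        by (rule has_fps_expansion_imp_continuous[OF has_fps_expansion_shift[OF d]]) (auto simp: m_def)
      then have limD: "((\<lambda>z. if z = 0 then fps_nth D m else d z / z ^ m) \<longlongrightarrow> fps_nth D m) (at 0)"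
        by (simp add: isCont_def)
      have "\<forall>\<^sub>F z in at 0. (if z = 0 then fps_nth D m else d z / z ^ m) = d z / z ^ m"
        using ev by (rule eventually_mono) simp
      from Lim_transform_eventually[OF limD this] lim0 have "fps_nth D m = 0"
        by (rule tendsto_unique[OF trivial_limit_at])
      with \<open>fps_nth D m \<noteq> 0\<close> show False ..
    qed
  next
    assume 0: "\<forall>k\<le>n. fps_nth D k = 0"
    \<comment> \<open>The quotient by X^(n+1) still has positive radius of convergence, so it is
      continuous and hence bounded near 0.\<close>
    define H where "H = fps_shift (Suc n) D"
    have DH: "D = fps_X ^ Suc n * H"
      using 0 by (intro fps_ext) (auto simp: H_def fps_X_power_mult_nth simp del: power_Suc)
    have "0 < fps_conv_radius H" using d by (simp add: H_def has_fps_expansion_def)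
    then have H: "eval_fps H has_fps_expansion H" by (rule eval_fps_has_fps_expansion)
    have "(\<lambda>z. z ^ Suc n * eval_fps H z) has_fps_expansion D"
      unfolding DH by (intro has_fps_expansion_mult has_fps_expansion_fps_X_power H)
    then have "eventually (\<lambda>z. eval_fps D z = z ^ Suc n * eval_fps H z) (nhds 0)"
      unfolding has_fps_expansion_def by blast
    moreover have "eventually (\<lambda>z. eval_fps D z = d z) (nhds 0)"
      using d unfolding has_fps_expansion_def by blast
    ultimately have "eventually (\<lambda>z. d z = z ^ Suc n * eval_fps H z) (nhds 0)"
      by eventually_elim simp
    then have ev: "eventually (\<lambda>z. d z = z ^ Suc n * eval_fps H z) (at 0)"
      unfolding eventually_at_filter by (rule eventually_mono) simp
    have "eval_fps H \<in> O[at 0](\<lambda>_. 1)"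
      by (intro continuous_imp_bigo_1 has_fps_expansion_imp_continuous[OF H])
    then have "(\<lambda>z. z ^ Suc n * eval_fps H z) \<in> O[at 0](\<lambda>z. z ^ Suc n * 1)"
      by (rule landau_o.big.mult[OF landau_o.big_refl])
    then show "d \<in> O[at 0](\<lambda>z. z ^ Suc n)"
      using landau_o.big.in_cong[OF ev] by simp
  qed
  then show ?thesis by (simp add: d_def D_def P)
qed

subsection \<open>The coefficient body\<close>

lemma coord_vec_lambda:
  assumes "k \<in> {1..CARD('n)}"
  shows "coord (\<chi> i::'n::{finite,linorder}. g (pos i)) k = g k"
proof -
  obtain i :: 'n where "pos i = k"
    using assms bij_betw_pos[where 'n = 'n] by (metis bij_betw_iff_bijections)
  then show ?thesis by (metis coord_pos vec_lambda_beta)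
qed

lemma pos_in: "pos (i :: 'n::{finite,linorder}) \<in> {1..CARD('n)}"
  using bij_betw_pos[where 'n = 'n] by (auto simp: bij_betw_def)

lemma all_index_iff_all_coord:
  fixes v :: "complex ^ 'n::{finite,linorder}"
  shows "(\<forall>i. P (v $ i)) \<longleftrightarrow> (\<forall>k\<in>{1..CARD('n)}. P (coord v k))"
proof -
  have "(\<forall>i. P (v $ i)) \<longleftrightarrow> (\<forall>i::'n. P (coord v (pos i)))"
    by (simp add: coord_pos)
  also have "\<dots> \<longleftrightarrow> (\<forall>k\<in>range (pos :: 'n \<Rightarrow> nat). P (coord v k))"
    by blast
  also have "range (pos :: 'n \<Rightarrow> nat) = {1..CARD('n)}"
    using bij_betw_pos[where 'n = 'n] by (simp add: bij_betw_def)
  finally show ?thesis .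
qed

lemma polydisk_iff_coord:
  fixes v :: "complex ^ 'n::{finite,linorder}"
  shows "v \<in> polydisk \<longleftrightarrow> (\<forall>k\<in>{1..CARD('n)}. cmod (coord v k) < 1)"
  using all_index_iff_all_coord[of "\<lambda>z. cmod z < 1" v] by (simp add: polydisk_def)

lemma closed_polydisk_iff_coord:
  fixes v :: "complex ^ 'n::{finite,linorder}"
  shows "v \<in> closed_polydisk \<longleftrightarrow> (\<forall>k\<in>{1..CARD('n)}. cmod (coord v k) \<le> 1)"
  using all_index_iff_all_coord[of "\<lambda>z. cmod z \<le> 1" v] by (simp add: closed_polydisk_def)

lemma coord_linear: "linear (\<lambda>v. coord v k)"
  unfolding coord_def by (rule bounded_linear.linear[OF bounded_linear_vec_nth])

lemma coord_diff: "coord (v - w) k = coord v k - coord w k"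
  by (rule linear_diff[OF coord_linear])

lemma coord_add: "coord (v + w) k = coord v k + coord w k"
  by (rule linear_add[OF coord_linear])

lemma coord_scaleR: "coord (r *\<^sub>R v) k = r *\<^sub>R coord v k"
  by (rule linear_scale[OF coord_linear])

lemma vec_eq_iff_coord:
  fixes v w :: "complex ^ 'n::{finite,linorder}"
  shows "v = w \<longleftrightarrow> (\<forall>k\<in>{1..CARD('n)}. coord v k = coord w k)"
  using all_index_iff_all_coord[of "\<lambda>z. z = 0" "v - w"] by (simp add: vec_eq_iff coord_diff)

lemma coord_T_vec:
  fixes \<gamma> :: "complex ^ 'n::{finite,linorder}"
  assumes "k \<in> {1..CARD('n)}"
  shows "coord (T_vec \<gamma>) k = T k (coord \<gamma>)"
  unfolding T_vec_def by (rule coord_vec_lambda[OF assms])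

text \<open>The image is described by the function class instead of by formulas; the coefficient
  body and convexity both follow from this description.\<close>

lemma T_vec_image_iff:
  fixes v :: "complex ^ 'n::{finite,linorder}"
  shows "v \<in> T_vec ` closed_polydisk \<longleftrightarrow>
    (\<exists>g\<in>caratheodory. \<forall>k\<in>{1..CARD('n)}. fps_nth (fps_expansion g 0) k = 2 * coord v k)"
proof -
  \<comment> \<open>The same relation serves both directions, whether g is constructed from f or f
    from g.\<close>
  have rel: "fps_expansion g 0 * (1 - fps_X * fps_expansion f 0) = 1 + fps_X * fps_expansion f 0"
    if "g \<in> caratheodory" "f \<in> schur_class" "\<And>z. z \<in> ball 0 1 \<Longrightarrow> g z * (1 - z * f z) = 1 + z * f z" for f g
  proof (rule fps_eq_of_unit_disc[OF _ _ that(3)])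
    have f: "f has_fps_expansion fps_expansion f 0"
      using that by (intro has_fps_expansion_unit_disc) (simp add: schur_class_def)
    have g: "g has_fps_expansion fps_expansion g 0"
      using that by (intro has_fps_expansion_unit_disc) (simp add: caratheodory_def)
    show "(\<lambda>z. g z * (1 - z * f z)) has_fps_expansion fps_expansion g 0 * (1 - fps_X * fps_expansion f 0)"
      by (intro has_fps_expansion_mult has_fps_expansion_diff has_fps_expansion_1 has_fps_expansion_fps_X f g)
    show "(\<lambda>z. 1 + z * f z) has_fps_expansion 1 + fps_X * fps_expansion f 0"
      by (intro has_fps_expansion_mult has_fps_expansion_add has_fps_expansion_1 has_fps_expansion_fps_X f)
  qed
  show ?thesis
  proof
    assume "v \<in> T_vec ` closed_polydisk"
    then obtain \<gamma> :: "(complex, 'n) vec" where \<gamma>: "v = T_vec \<gamma>" "\<gamma> \<in> closed_polydisk" by blast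
    then have "\<exists>f\<in>schur_class. \<forall>k\<in>{1..CARD('n)}. fps_nth (fps_expansion f 0) (k - 1) = F k (coord \<gamma>)"
      by (intro schur_class_of_parameters) (simp add: closed_polydisk_iff_coord)
    then obtain f where f: "f \<in> schur_class"
      "\<And>k. k \<in> {1..CARD('n)} \<Longrightarrow> fps_nth (fps_expansion f 0) (k - 1) = F k (coord \<gamma>)" by blast
    obtain g where g: "g \<in> caratheodory" "\<And>z. z \<in> ball 0 1 \<Longrightarrow> g z * (1 - z * f z) = 1 + z * f z"
      using caratheodory_of_schur[OF f(1)] by blast
    have "fps_nth (fps_expansion g 0) k = 2 * T k (coord \<gamma>)" if "k \<in> {1..CARD('n)}" for k
      by (rule fps_nth_caratheodory_step[OF rel[OF g(1) f(1) g(2)] f(2) that])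
    then show "\<exists>g\<in>caratheodory. \<forall>k\<in>{1..CARD('n)}. fps_nth (fps_expansion g 0) k = 2 * coord v k"
      using g(1) \<gamma>(1) by (intro bexI[of _ g]) (simp_all add: coord_T_vec)
  next
    assume "\<exists>g\<in>caratheodory. \<forall>k\<in>{1..CARD('n)}. fps_nth (fps_expansion g 0) k = 2 * coord v k"
    then obtain g where g: "g \<in> caratheodory"
      "\<And>k. k \<in> {1..CARD('n)} \<Longrightarrow> fps_nth (fps_expansion g 0) k = 2 * coord v k" by blast
    obtain f where f: "f \<in> schur_class" "\<And>z. z \<in> ball 0 1 \<Longrightarrow> g z * (1 - z * f z) = 1 + z * f z"
      using schur_of_caratheodory[OF g(1)] by blast
    obtain \<gamma> where \<gamma>: "\<And>j. cmod (\<gamma> j) \<le> 1"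
      "\<And>k. k \<in> {1..CARD('n)} \<Longrightarrow> fps_nth (fps_expansion f 0) (k - 1) = F k \<gamma>"
      using parameters_of_schur_class[OF f(1)] by blast
    \<comment> \<open>The parameter sequence is cut off after n entries, which \<open>T_cong\<close>
      permits.\<close>
    define x :: "(complex, 'n) vec" where "x = (\<chi> i. \<gamma> (pos i))"
    have "coord v k = coord (T_vec x) k" if k: "k \<in> {1..CARD('n)}" for k
    proof -
      have "2 * coord v k = 2 * T k \<gamma>"
        using fps_nth_caratheodory_step[OF rel[OF g(1) f(1) f(2)] \<gamma>(2) k] g(2)[OF k] by simp
      also have "T k \<gamma> = T k (coord x)"
        using k unfolding x_def by (intro T_cong coord_vec_lambda[symmetric]) auto
      finally show ?thesis using k by (simp add: coord_T_vec)
    qed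
    then have "v = T_vec x" by (simp add: vec_eq_iff_coord)
    moreover have "x \<in> closed_polydisk" using \<gamma>(1) by (simp add: x_def closed_polydisk_def)
    ultimately show "v \<in> T_vec ` closed_polydisk" by blast
  qed
qed

lemma fps_expansion_caratheodory:
  "g \<in> caratheodory \<Longrightarrow> g has_fps_expansion fps_expansion g 0"
  by (intro has_fps_expansion_unit_disc) (simp add: caratheodory_def)

lemma coefficient_body_caratheodory:
  "coefficient_body caratheodory =
    {1} \<times> ((\<lambda>v. 2 *\<^sub>R v) ` (T_vec ` (closed_polydisk :: (complex ^ 'n::{finite,linorder}) set)))"
proof -
  have iff: "(\<lambda>z. g z - (a0 + (\<Sum>k = 1..CARD('n). coord a k * z ^ k))) \<in> O[at 0](\<lambda>z. z ^ (CARD('n) + 1)) \<longleftrightarrow>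
      a0 = 1 \<and> (\<forall>k\<in>{1..CARD('n)}. fps_nth (fps_expansion g 0) k = coord a k)"
    if g: "g \<in> caratheodory" for g a0 and a :: "(complex, 'n) vec"
  proof -
    \<comment> \<open>One coefficient sequence starting at index 0, in the form that
      \<open>bigo_taylor_iff\<close> takes.\<close>
    define b where "b = (\<lambda>k. if k = 0 then a0 else coord a k)"
    have "{..CARD('n)} = insert 0 {1..CARD('n)}" by auto
    then have sum: "(\<Sum>k\<le>CARD('n). b k * z ^ k) = a0 + (\<Sum>k = 1..CARD('n). coord a k * z ^ k)" for z
      by (simp add: b_def)
    have "fps_nth (fps_expansion g 0) 0 = 1"
      using g by (simp add: fps_expansion_def caratheodory_def)
    moreover have "(\<forall>k\<le>CARD('n). fps_nth (fps_expansion g 0) k = b k) \<longleftrightarrow>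
        fps_nth (fps_expansion g 0) 0 = a0 \<and> (\<forall>k\<in>{1..CARD('n)}. fps_nth (fps_expansion g 0) k = coord a k)"
      by (auto simp: b_def)
    ultimately show ?thesis
      using bigo_taylor_iff[OF fps_expansion_caratheodory[OF g], where n = "CARD('n)" and a = b] unfolding sum by auto
  qed
  have "(a0, a) \<in> coefficient_body caratheodory \<longleftrightarrow>
      (a0, a) \<in> {1} \<times> ((\<lambda>v. 2 *\<^sub>R v) ` (T_vec ` (closed_polydisk :: (complex, 'n) vec set)))" for a0 and a :: "(complex, 'n) vec"
  proof -
    have "(a0, a) \<in> coefficient_body caratheodory \<longleftrightarrow> a0 = 1 \<and>
        (\<exists>g\<in>caratheodory. \<forall>k\<in>{1..CARD('n)}. fps_nth (fps_expansion g 0) k = coord a k)"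
      unfolding coefficient_body_def using iff by auto
    also have "(\<exists>g\<in>caratheodory. \<forall>k\<in>{1..CARD('n)}. fps_nth (fps_expansion g 0) k = coord a k) \<longleftrightarrow>
        (1/2) *\<^sub>R a \<in> T_vec ` closed_polydisk"
      unfolding T_vec_image_iff coord_scaleR by (simp add: scaleR_conv_of_real)
    also have "\<dots> \<longleftrightarrow> a \<in> (\<lambda>v. 2 *\<^sub>R v) ` (T_vec ` closed_polydisk)"
    proof
      assume "(1/2) *\<^sub>R a \<in> T_vec ` closed_polydisk"
      then show "a \<in> (\<lambda>v. 2 *\<^sub>R v) ` (T_vec ` closed_polydisk)"
        by (rule image_eqI[rotated]) simp
    next
      assume "a \<in> (\<lambda>v. 2 *\<^sub>R v) ` (T_vec ` closed_polydisk)"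
      then obtain v where "a = 2 *\<^sub>R v" "v \<in> T_vec ` closed_polydisk" by (rule imageE)
      then show "(1/2) *\<^sub>R a \<in> T_vec ` closed_polydisk" by simp
    qed
    finally show ?thesis by simp
  qed
  then show ?thesis by (intro set_eqI) (simp only: split_paired_all)
qed

text \<open>The Caratheodory class is convex and Taylor coefficients are linear, so a convex
  combination of points comes from that of the functions.\<close>

lemma convex_T_vec_image: "convex (T_vec ` (closed_polydisk :: (complex ^ 'n::{finite,linorder}) set))"
proof (rule convexI)
  fix v w :: "(complex, 'n) vec" and s t :: real
  assume v: "v \<in> T_vec ` closed_polydisk" and w: "w \<in> T_vec ` closed_polydisk"
    and st: "0 \<le> s" "0 \<le> t" "s + t = 1"
  obtain g where g: "g \<in> caratheodory" "\<And>k. k \<in> {1..CARD('n)} \<Longrightarrow> fps_nth (fps_expansion g 0) k = 2 * coord v k"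
    using v unfolding T_vec_image_iff by blast
  obtain h where h: "h \<in> caratheodory" "\<And>k. k \<in> {1..CARD('n)} \<Longrightarrow> fps_nth (fps_expansion h 0) k = 2 * coord w k"
    using w unfolding T_vec_image_iff by blast
  define f where "f = (\<lambda>z. of_real s * g z + of_real t * h z)"
  have "0 < s * Re (g z) + t * Re (h z)" if "z \<in> ball 0 1" for z
  proof -
    have "0 < Re (g z)" "0 < Re (h z)" using g(1) h(1) that by (auto simp: caratheodory_def)
    then show ?thesis
      \<comment> \<open>The weights sum to 1, so one of the two summands is strictly
        positive.\<close>
      using st by (cases "s = 0") (auto intro: add_pos_nonneg)
  qed
  moreover have "f holomorphic_on ball 0 1"
    using g(1) h(1) unfolding f_def caratheodory_def by (auto intro!: holomorphic_intros)
  moreover have "f 0 = 1"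
    using g(1) h(1) st by (simp add: f_def caratheodory_def flip: of_real_add)
  ultimately have f: "f \<in> caratheodory" by (simp add: caratheodory_def f_def)
  have "f has_fps_expansion fps_const (of_real s) * fps_expansion g 0 + fps_const (of_real t) * fps_expansion h 0"
    unfolding f_def
    by (intro has_fps_expansion_add has_fps_expansion_mult has_fps_expansion_const fps_expansion_caratheodory g(1) h(1))
  then have "fps_expansion f 0 = fps_const (of_real s) * fps_expansion g 0 + fps_const (of_real t) * fps_expansion h 0"
    by (rule fps_expansion_eqI)
  then have "fps_nth (fps_expansion f 0) k = 2 * coord (s *\<^sub>R v + t *\<^sub>R w) k" if "k \<in> {1..CARD('n)}" for k
    unfolding coord_add coord_scaleR scaleR_conv_of_real[of _ "coord _ _"]
    using g(2)[OF that] h(2)[OF that] by (simp add: algebra_simps)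
  with f show "s *\<^sub>R v + t *\<^sub>R w \<in> T_vec ` closed_polydisk"
    unfolding T_vec_image_iff by blast
qed

section \<open>Topology: compactness, injectivity inside, behaviour on the boundary\<close>

lemma continuous_on_T_vec: "continuous_on S T_vec"
  unfolding T_vec_def
  by (intro continuous_on_vec_lambda continuous_on_T)
     (simp add: linear_continuous_on linear_conv_bounded_linear[THEN iffD1] coord_linear)

lemma compact_closed_polydisk: "compact (closed_polydisk :: (complex ^ 'n) set)"
proof -
  have "norm v \<le> CARD('n)" if "v \<in> closed_polydisk" for v :: "(complex, 'n) vec"
  proof -
    have "norm v \<le> (\<Sum>i\<in>UNIV. norm (v $ i))"
      unfolding norm_vec_def by (rule L2_set_le_sum) simp
    also have "\<dots> \<le> (\<Sum>i\<in>(UNIV :: 'n set). 1)"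
      using that by (intro sum_mono) (simp add: closed_polydisk_def)
    finally show ?thesis by simp
  qed
  then have "bounded (closed_polydisk :: (complex, 'n) vec set)" by (auto simp: bounded_iff)
  moreover have "closed (closed_polydisk :: (complex, 'n) vec set)"
    unfolding closed_polydisk_def mem_cball dist_0_norm
    by (intro closed_Collect_all closed_Collect_le continuous_intros)
  ultimately show ?thesis by (simp add: compact_eq_bounded_closed)
qed

lemma open_polydisk: "open (polydisk :: (complex ^ 'n) set)"
proof -
  have "polydisk = (\<Inter>i. (\<lambda>v :: (complex, 'n) vec. v $ i) -` ball 0 1)"
    by (auto simp: polydisk_def)
  moreover have "open (\<Inter>i. (\<lambda>v :: (complex, 'n) vec. v $ i) -` ball 0 1)"
    by (intro open_INT) (auto intro!: open_vimage_vec_nth)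
  ultimately show ?thesis by simp
qed

lemma polydisk_subset_closed: "polydisk \<subseteq> closed_polydisk"
  by (auto simp: polydisk_def closed_polydisk_def less_imp_le)

lemma inj_on_T_vec_polydisk: "inj_on T_vec (polydisk :: (complex ^ 'n::{finite,linorder}) set)"
proof (rule inj_onI)
  fix v w :: "(complex, 'n) vec"
  assume "v \<in> polydisk" "w \<in> polydisk" "T_vec v = T_vec w"
  then have "coord v k = coord w k" if "k \<in> {1..CARD('n)}" for k
    using that coord_T_vec[of _ v] coord_T_vec[of _ w]
    by (intro T_inj[of "CARD('n)" "coord v" "coord w"]) (auto simp: polydisk_iff_coord)
  then show "v = w" by (simp add: vec_eq_iff_coord)
qed

text \<open>If \<gamma>_k is the first unimodular parameter, then T_1, ..., T_(k-1) determine \<gamma>_1, ..., \<gamma>_(k-1),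
  and T_k depends affinely on \<gamma>_k; so moving T_k outwards would force the k-th parameter out of
  the closed disc.\<close>

lemma T_vec_boundary_not_interior:
  fixes \<gamma> :: "complex ^ 'n::{finite,linorder}"
  assumes "\<gamma> \<in> closed_polydisk" "\<gamma> \<notin> polydisk"
  shows "T_vec \<gamma> \<notin> interior (T_vec ` closed_polydisk)"
proof
  assume "T_vec \<gamma> \<in> interior (T_vec ` closed_polydisk)"
  then obtain e where e: "0 < e" "ball (T_vec \<gamma>) e \<subseteq> T_vec ` closed_polydisk"
    by (auto simp: mem_interior)
  define k where "k = (LEAST k. k \<in> {1..CARD('n)} \<and> \<not> cmod (coord \<gamma> k) < 1)"
  have "\<exists>k. k \<in> {1..CARD('n)} \<and> \<not> cmod (coord \<gamma> k) < 1"
    using assms(2) by (auto simp: polydisk_iff_coord)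
  from LeastI_ex[OF this] have k: "k \<in> {1..CARD('n)}" "\<not> cmod (coord \<gamma> k) < 1"
    by (simp_all add: k_def)
  have less: "cmod (coord \<gamma> j) < 1" if "j \<in> {1..<k}" for j
  proof -
    have "j < (LEAST k. k \<in> {1..CARD('n)} \<and> \<not> cmod (coord \<gamma> k) < 1)"
      using that by (simp only: k_def atLeastLessThan_iff)
    from not_less_Least[OF this] show ?thesis using that k(1) by auto
  qed
  have unit: "cmod (coord \<gamma> k) = 1"
    using k assms(1) by (force simp: closed_polydisk_iff_coord)
  define p where "p = (\<Prod>j = 1..<k. of_real (1 - (cmod (coord \<gamma> j))\<^sup>2) :: complex)"
  have p: "p \<noteq> 0" unfolding p_def by (rule prod_one_minus_norm_neq_0[OF less])
  \<comment> \<open>The direction changes the k-th coordinate only; its factor \<open>p\<close>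
    cancels against the pivot, so the k-th parameter of the shifted point is exactly (1 + s)
    \<gamma>_k. The size of \<open>s\<close> keeps the shift inside the ball.\<close>
  define d :: "(complex, 'n) vec" where "d = (\<chi> i. if pos i = k then p * coord \<gamma> k else 0)"
  define s where "s = e / (2 * (norm d + 1))"
  have s: "0 < s" using e(1) by (simp add: s_def add_nonneg_pos)
  have "norm (s *\<^sub>R d) < e"
  proof -
    have "norm (s *\<^sub>R d) = s * norm d" using s by simp
    also have "\<dots> = e / 2 * (norm d / (norm d + 1))" by (simp add: s_def)
    also have "\<dots> \<le> e / 2 * 1"
      using e(1) by (intro mult_left_mono) (auto simp: divide_le_eq_1 add_nonneg_pos)
    finally show ?thesis using e(1) by simp
  qed
  then have "T_vec \<gamma> + s *\<^sub>R d \<in> ball (T_vec \<gamma>) e" by (simp add: dist_norm)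
  with e(2) obtain \<delta> where \<delta>: "\<delta> \<in> closed_polydisk" "T_vec \<delta> = T_vec \<gamma> + s *\<^sub>R d" by auto
  have coord_d: "coord d j = (if j = k then p * coord \<gamma> k else 0)" if "j \<in> {1..CARD('n)}" for j
    unfolding d_def by (rule coord_vec_lambda[OF that])
  have T: "T j (coord \<delta>) = T j (coord \<gamma>) + of_real s * (if j = k then p * coord \<gamma> k else 0)"
    if "j \<in> {1..CARD('n)}" for j
    using coord_T_vec[OF that, of \<delta>] coord_T_vec[OF that, of \<gamma>] coord_d[OF that]
    unfolding \<delta>(2) coord_add coord_scaleR by (simp add: scaleR_conv_of_real)
  have eq: "coord \<gamma> j = coord \<delta> j" if "j \<in> {1..<k}" for j
    using that k(1) T less by (intro T_inj[of "k - 1" "coord \<gamma>" "coord \<delta>"]) auto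
  have "(\<Prod>j = 1..<k. of_real (1 - (cmod (coord \<delta> j))\<^sup>2)) = p"
    unfolding p_def using eq by (intro prod.cong) auto
  moreover have "T k ((coord \<delta>)(k := 0)) = T k ((coord \<gamma>)(k := 0))"
    using eq by (intro T_cong) auto
  ultimately have "p * coord \<delta> k = p * coord \<gamma> k + of_real s * (p * coord \<gamma> k)"
    using T[OF k(1)] T_triangular[of k "coord \<delta>"] T_triangular[of k "coord \<gamma>"] k(1)
    by (simp add: p_def)
  then have "p * coord \<delta> k = p * (of_real (1 + s) * coord \<gamma> k)" by (simp add: algebra_simps)
  with p have "coord \<delta> k = of_real (1 + s) * coord \<gamma> k" by simp
  then have "cmod (coord \<delta> k) = \<bar>1 + s\<bar> * cmod (coord \<gamma> k)"
    by (simp only: norm_mult norm_of_real)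
  then have "cmod (coord \<delta> k) = 1 + s" using unit s by simp
  moreover have "cmod (coord \<delta> k) \<le> 1"
    using \<delta>(1) k(1) unfolding closed_polydisk_iff_coord by blast
  ultimately show False using s by simp
qed

section \<open>Real analyticity of the map and of its inverse\<close>

lemma real_analytic_on_T_vec:
  "open S \<Longrightarrow> (T_vec :: complex ^ 'n::{finite,linorder} \<Rightarrow> _) real_analytic_on S"
  unfolding T_vec_def
  by (rule real_analytic_on_vecI) (simp_all add: analytic_germ_T analytic_germ_linear coord_linear)

text \<open>Forward substitution: once \<gamma>_1, ..., \<gamma>_(k-1) are analytic in w, so is
  \<gamma>_k = (w_k - T_k(\<gamma>_1, ..., \<gamma>_(k-1), 0)) / p, where the pivot product p has no
  zeros on \<open>S\<close>. No derivative of \<open>T_vec\<close> enters.\<close>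

lemma real_analytic_on_T_vec_inverse:
  fixes S :: "(complex ^ 'n::{finite,linorder}) set"
  assumes S: "open S" and img: "T_vec ` polydisk = S"
  shows "inv_into polydisk T_vec real_analytic_on S"
proof (rule real_analytic_on_vecI[OF S])
  fix w0 and i :: 'n
  assume w0: "w0 \<in> S"
  define G where "G = inv_into (polydisk :: (complex, 'n) vec set) T_vec"
  have G: "G w \<in> polydisk" "T_vec (G w) = w" if "w \<in> S" for w
    using that img inv_into_into[of w T_vec polydisk] f_inv_into_f[of w T_vec polydisk]
    by (auto simp: G_def)
  have "analytic_germ w0 (\<lambda>w. coord (G w) k)" if "k \<in> {1..CARD('n)}" for k
    using that
  proof (induction k rule: less_induct)
    case (less k)
    define p where "p = (\<lambda>w. \<Prod>j = 1..<k. of_real (1 - (cmod (coord (G w) j))\<^sup>2) :: complex)"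
    have p: "p w \<noteq> 0" if "w \<in> S" for w
      unfolding p_def using G(1)[OF that] less.prems
      by (intro prod_one_minus_norm_neq_0) (auto simp: polydisk_iff_coord)
    have "analytic_germ w0 p"
      unfolding p_def of_real_diff complex_norm_square of_real_1 using less
      by (intro analytic_germ_prod analytic_germ_diff analytic_germ_mult analytic_germ_cnj analytic_germ_const) auto
    moreover have "analytic_germ w0 (\<lambda>w. T k ((coord (G w))(k := 0)))"
    proof (rule analytic_germ_T)
      fix j assume "j \<in> {1..k}"
      then show "analytic_germ w0 (\<lambda>w. ((coord (G w))(k := 0)) j)"
        using less by (cases "j = k") auto
    qed
    ultimately have "analytic_germ w0 (\<lambda>w. (coord w k - T k ((coord (G w))(k := 0))) * inverse (p w))"
      using p[OF w0] by (intro analytic_germ_mult analytic_germ_diff analytic_germ_inverse analytic_germ_linear[OF coord_linear]) simp_all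
    then show ?case
    proof (rule analytic_germ_cong[OF _ S w0])
      fix w assume w: "w \<in> S"
      have "coord w k = p w * coord (G w) k + T k ((coord (G w))(k := 0))"
        using T_triangular[of k "coord (G w)"] coord_T_vec[OF less.prems, of "G w"] less.prems
        unfolding G(2)[OF w] p_def by simp
      then show "(coord w k - T k ((coord (G w))(k := 0))) * inverse (p w) = coord (G w) k"
        using p[OF w] by (simp add: field_simps)
    qed
  qed
  from this[OF pos_in[of i]] show "analytic_germ w0 (\<lambda>w. inv_into polydisk T_vec w $ i)"
    by (simp add: coord_pos G_def)
qed

text \<open>On the face \<gamma>_1 = 1 every F k with k \<ge> 2 vanishes, so \<open>T_vec\<close> is
  constant there; for n \<ge> 2 the face has more than one point.\<close>

lemma not_inj_on_T_vec_boundary: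
  assumes "2 \<le> CARD('n)"
  shows "\<not> inj_on T_vec (closed_polydisk - polydisk :: (complex ^ 'n::{finite,linorder}) set)"
proof
  assume inj: "inj_on T_vec (closed_polydisk - polydisk :: (complex, 'n) vec set)"
  define v :: "complex \<Rightarrow> (complex, 'n) vec" where "v = (\<lambda>c. \<chi> i. if pos i = 1 then 1 else c)"
  have coord_v: "coord (v c) k = (if k = 1 then 1 else c)" if "k \<in> {1..CARD('n)}" for c k
    unfolding v_def by (rule coord_vec_lambda[OF that])
  have F: "F k (coord (v c)) = (if k = 1 then 1 else 0)" if "k \<in> {1..CARD('n)}" for c k
    using that F_eq_0[of "coord (v c)" k] coord_v[of 1 c] by (cases "k = 1") auto
  have "T k (coord (v 0)) = T k (coord (v 1))" if "k \<in> {1..CARD('n)}" for k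
    unfolding T_def using that F by (intro Q_cong) auto
  then have "T_vec (v 0) = T_vec (v 1)" by (simp add: vec_eq_iff_coord coord_T_vec)
  moreover have "v c \<in> closed_polydisk - polydisk" if "cmod c \<le> 1" for c
  proof -
    have "cmod (coord (v c) 1) = 1" using coord_v[of 1 c] by simp
    moreover have "1 \<in> {1..CARD('n)}" using assms by simp
    ultimately have "v c \<notin> polydisk" unfolding polydisk_iff_coord by (metis less_irrefl)
    moreover have "v c \<in> closed_polydisk"
      unfolding closed_polydisk_iff_coord using that coord_v by simp
    ultimately show ?thesis by blast
  qed
  ultimately have "v 0 = v 1" using inj_onD[OF inj, of "v 0" "v 1"] by simp
  then show False using coord_v[of 2 0] coord_v[of 2 1] assms by simp
qed

theorem theorem4p1:
  shows "\<exists>V :: (complex ^ 'n::{finite,linorder}) set.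
     coefficient_body caratheodory = {1} \<times> ((\<lambda>v. 2 *\<^sub>R v) ` V) \<and>
     convex_body V \<and>
     continuous_on closed_polydisk (T_vec :: complex ^ 'n::{finite,linorder} \<Rightarrow> _) \<and>
     T_vec ` closed_polydisk = V \<and>
     T_vec ` polydisk = interior V \<and>
     T_vec ` (closed_polydisk - polydisk) = frontier V \<and>
     real_analytic_diffeomorphism T_vec polydisk (interior V) \<and>
     (CARD('n) \<ge> 2 \<longrightarrow>
        \<not> inj_on (T_vec :: complex ^ 'n::{finite,linorder} \<Rightarrow> _) (closed_polydisk - polydisk))"
proof -
  define V :: "(complex, 'n) vec set" where "V = T_vec ` closed_polydisk"
  have "compact V"
    unfolding V_def by (rule compact_continuous_image[OF continuous_on_T_vec compact_closed_polydisk])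
  have "open (T_vec ` (polydisk :: (complex, 'n) vec set))"
    by (rule invariance_of_domain[OF continuous_on_T_vec open_polydisk inj_on_T_vec_polydisk])
  then have inner: "T_vec ` polydisk \<subseteq> interior V"
    using polydisk_subset_closed unfolding V_def by (intro interior_maximal image_mono)
  have outer: "T_vec ` (closed_polydisk - polydisk) \<inter> interior V = {}"
    using T_vec_boundary_not_interior unfolding V_def by blast
  have "polydisk \<union> (closed_polydisk - polydisk) = (closed_polydisk :: (complex, 'n) vec set)"
    using polydisk_subset_closed by blast
  then have union: "V = T_vec ` polydisk \<union> T_vec ` (closed_polydisk - polydisk)"
    unfolding V_def image_Un[symmetric] by (simp only:)
  \<comment> \<open>The inclusions for the two pieces and the covering of V force both equalities by
    set algebra; surjectivity onto the interior and onto the frontier comes out together.\<close>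
  have "A = I \<and> B = U - I" if "A \<subseteq> I" "B \<inter> I = {}" "U = A \<union> B" "I \<subseteq> U"
    for A B I U :: "(complex, 'n) vec set"
    using that by blast
  from this[OF inner outer union interior_subset]
  have int: "T_vec ` polydisk = interior V" and bd: "T_vec ` (closed_polydisk - polydisk) = V - interior V"
    by (rule conjunct1, rule conjunct2)
  have "closure V = V"
    using compact_imp_closed[OF \<open>compact V\<close>] by (rule closure_closed)
  with bd have fr: "T_vec ` (closed_polydisk - polydisk) = frontier V"
    by (simp only: frontier_def)
  have "(0 :: (complex, 'n) vec) \<in> polydisk" by (simp add: polydisk_def)
  then have "interior V \<noteq> {}" using inner by blast
  moreover have "convex V" unfolding V_def by (rule convex_T_vec_image)
  ultimately have "convex_body V" using \<open>compact V\<close> by (simp add: convex_body_def)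
  moreover have "real_analytic_diffeomorphism T_vec polydisk (interior V)"
    unfolding real_analytic_diffeomorphism_def bij_betw_def
    by (intro conjI inj_on_T_vec_polydisk int real_analytic_on_T_vec open_polydisk
        real_analytic_on_T_vec_inverse open_interior)
  moreover have "coefficient_body caratheodory = {1} \<times> ((\<lambda>v. 2 *\<^sub>R v) ` V)"
    unfolding V_def by (rule coefficient_body_caratheodory)
  ultimately show ?thesis
    using V_def int fr continuous_on_T_vec not_inj_on_T_vec_boundary
    by (intro exI[of _ V] conjI impI) simp_all
qed

end
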